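(* For every large semi-walled wedge there exists a finite deterministic automaton that explores it using two pebbles.
   Context: The oriented grid $\mathbb{Z}\times\mathbb{Z}$ is embedded in the plane (nodes at integer points, edges between nodes at distance 1); nodes are anonymous and every node has ports $N,E,S,W$ pointing North, East, South, West. Given two half-lines $H_1,H_2$ in the plane with a common origin $O$ (an arbitrary point; arbitrary real directions), let $W(H_1,H_2)$ be the closed region swept clockwise from $H_1$ to $H_2$ (half-lines included); the wedge is the subgraph of the grid induced by the grid nodes in $W(H_1,H_2)$. It is large if the clockwise angle $\alpha$ from $H_1$ to $H_2$ satisfies $\pi\le\alpha\le2\pi$. Consider grid edges $\{u,v\}$ with $u$ in the wedge, $v$ not in the wedge and $H_i$ meeting the closed segment $[u,v]$: $H_i$ is a wall if the ports of all such edges at $u$ and $v$ are blocked (cannot be taken), and free if they are free. A wedge is semi-walled if $H_1$ is a wall and $H_2$ is free; all other ports are free. The agent is a finite deterministic (Mealy) automaton carrying $p$ pebbles: at each step it sees which ports at the current node are free, whether a pebble lies there, and how many pebbles it carries; depending on its state and this input it moves through a free port, possibly dropping a pebble on the empty current node (if it carries one) or picking up the pebble lying there, and changes state. It starts in its initial state with all $p$ pebbles, no pebbles on the grid, at an adversarially chosen node of the wedge. The automaton (which may depend on $H_1,H_2$ but not on the starting node) explores the wedge if for every starting node every node of the wedge is eventually visited.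
   Formalization: The half-lines H1 and H2 are required to be different, excluding angle 2π, where the wedge is the whole unobstructed grid and two pebbles do not suffice; a crossing edge through O that meets both H1 and H2 is taken to be blocked. *)

theory Defs
  imports "HOL-Analysis.Analysis"
begin

text \<open>The plane is identified with the complex numbers, North being the direction of the
  positive imaginary axis.\<close>

type_synonym node = "int \<times> int"

datatype port = North | East | South | West

fun neighbour :: "node \<Rightarrow> port \<Rightarrow> node" where
  "neighbour (x, y) North = (x, y + 1)"
| "neighbour (x, y) East = (x + 1, y)"
| "neighbour (x, y) South = (x, y - 1)"
| "neighbour (x, y) West = (x - 1, y)"

fun opposite :: "port \<Rightarrow> port" where
  "opposite North = South"
| "opposite East = West"
| "opposite South = North"
| "opposite West = East"

definition point :: "node \<Rightarrow> complex" where
  "point u = Complex (of_int (fst u)) (of_int (snd u))"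

definition half_line :: "complex \<Rightarrow> real \<Rightarrow> complex set" where
  "half_line orig a = {orig + of_real r * cis a | r. 0 \<le> r}"

text \<open>Half-lines are given by their common origin and direction angles. The angles
  \<open>a1\<close> and \<open>a2\<close> of \<open>H\<^sub>1\<close> and \<open>H\<^sub>2\<close> are normalised so that the clockwise angle from \<open>H\<^sub>1\<close> to
  \<open>H\<^sub>2\<close> is \<open>a1 - a2\<close>; this also distinguishes the angles \<open>0\<close> and \<open>2 * pi\<close>
  when \<open>H\<^sub>1 = H\<^sub>2\<close>.\<close>

definition wedge_region :: "complex \<Rightarrow> real \<Rightarrow> real \<Rightarrow> complex set" where
  "wedge_region orig a1 a2 = (\<Union>a\<in>{a2..a1}. half_line orig a)"

definition wedge :: "complex \<Rightarrow> real \<Rightarrow> real \<Rightarrow> node set" where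
  "wedge orig a1 a2 = {u. point u \<in> wedge_region orig a1 a2}"

definition large :: "real \<Rightarrow> real \<Rightarrow> bool" where
  "large a1 a2 \<longleftrightarrow> pi \<le> a1 - a2 \<and> a1 - a2 \<le> 2 * pi"

text \<open>An edge \<open>{u, v}\<close> with \<open>u\<close> in the wedge and \<open>v\<close> outside is represented by
  \<open>u\<close> and its port leading to \<open>v\<close>.\<close>

definition crossing_edges :: "node set \<Rightarrow> complex set \<Rightarrow> (node \<times> port) set" where
  "crossing_edges V H = {(u, d). u \<in> V \<and> neighbour u d \<notin> V \<and>
     H \<inter> closed_segment (point u) (point (neighbour u d)) \<noteq> {}}"

definition edges_blocked :: "(node \<Rightarrow> port \<Rightarrow> bool) \<Rightarrow> (node \<times> port) set \<Rightarrow> bool" where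
  "edges_blocked blocked F \<longleftrightarrow>
     (\<forall>(u, d)\<in>F. blocked u d \<and> blocked (neighbour u d) (opposite d))"

definition edges_free :: "(node \<Rightarrow> port \<Rightarrow> bool) \<Rightarrow> (node \<times> port) set \<Rightarrow> bool" where
  "edges_free blocked F \<longleftrightarrow>
     (\<forall>(u, d)\<in>F. \<not> blocked u d \<and> \<not> blocked (neighbour u d) (opposite d))"

text \<open>In a large wedge, a crossing edge can meet both half-lines only at their common origin. The
  origin belongs to the wall \<open>H\<^sub>1\<close>, so such an edge is blocked; freeness of \<open>H\<^sub>2\<close> concerns the
  remaining edges crossing \<open>H\<^sub>2\<close>. Moreover, one and the same half-line cannot be both a wall and
  free, whence \<open>H\<^sub>1 \<noteq> H\<^sub>2\<close>: if \<open>H\<^sub>1 = H\<^sub>2\<close> and the angle is \<open>2 * pi\<close>, there are no crossing edges,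
  and the other conditions would merely describe the whole grid without any wall.\<close>

definition semi_walled ::
  "complex \<Rightarrow> real \<Rightarrow> real \<Rightarrow> (node \<Rightarrow> port \<Rightarrow> bool) \<Rightarrow> bool" where
  "semi_walled orig a1 a2 blocked \<longleftrightarrow>
     (let H1 = half_line orig a1; H2 = half_line orig a2;
          F1 = crossing_edges (wedge orig a1 a2) H1;
          F2 = crossing_edges (wedge orig a1 a2) H2
      in H1 \<noteq> H2 \<and> edges_blocked blocked F1 \<and> edges_free blocked (F2 - F1) \<and>
         (\<forall>u d. (u, d) \<notin> F1 \<union> F2 \<and> (neighbour u d, opposite d) \<notin> F1 \<union> F2
            \<longrightarrow> \<not> blocked u d))"

datatype pebble_action = Keep | Drop | Pick

text \<open>The input of the transition function consists of the set of free ports at the current node,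
  whether a pebble lies there, and the number of pebbles carried. The pebble action takes place at
  the current node, before the move.\<close>

record 'q automaton =
  states :: "'q set"
  init :: 'q
  trans :: "'q \<Rightarrow> port set \<Rightarrow> bool \<Rightarrow> nat \<Rightarrow> 'q \<times> pebble_action \<times> port"

text \<open>Inputs without any free port need no legal move; they do not arise in semi-walled
  large wedges.\<close>

definition valid_automaton :: "nat \<Rightarrow> 'q automaton \<Rightarrow> bool" where
  "valid_automaton p A \<longleftrightarrow> finite (states A) \<and> init A \<in> states A \<and>
     (\<forall>q\<in>states A. \<forall>F b k. F \<noteq> {} \<and> k \<le> p \<longrightarrow>
        (case trans A q F b k of (q', act, d) \<Rightarrow>
           q' \<in> states A \<and> d \<in> F \<and>
           (act = Drop \<longrightarrow> \<not> b \<and> 0 < k) \<and> (act = Pick \<longrightarrow> b)))"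

record 'q config =
  state :: 'q
  position :: node
  pebbles :: "node set"
  carried :: nat

definition step ::
  "(node \<Rightarrow> port \<Rightarrow> bool) \<Rightarrow> 'q automaton \<Rightarrow> 'q config \<Rightarrow> 'q config" where
  "step blocked A c =
     (let u = position c; B = pebbles c; k = carried c in
      case trans A (state c) {d. \<not> blocked u d} (u \<in> B) k of (q', act, d) \<Rightarrow>
        \<lparr>state = q',
         position = neighbour u d,
         pebbles = (case act of Keep \<Rightarrow> B | Drop \<Rightarrow> insert u B | Pick \<Rightarrow> B - {u}),
         carried = (case act of Keep \<Rightarrow> k | Drop \<Rightarrow> k - 1 | Pick \<Rightarrow> k + 1)\<rparr>)"

definition start :: "nat \<Rightarrow> 'q automaton \<Rightarrow> node \<Rightarrow> 'q config" where
  "start p A s = \<lparr>state = init A, position = s, pebbles = {}, carried = p\<rparr>"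

definition explores ::
  "(node \<Rightarrow> port \<Rightarrow> bool) \<Rightarrow> node set \<Rightarrow> nat \<Rightarrow> 'q automaton \<Rightarrow> bool" where
  "explores blocked V p A \<longleftrightarrow>
     (\<forall>s\<in>V. \<forall>w\<in>V. \<exists>n. position ((step blocked A ^^ n) (start p A s)) = w)"

end

theory Submission
  imports Defs
begin

text \<open>Since \<open>H\<^sub>2\<close> is free and the angle is at least \<open>\<pi>\<close>, the wedge with its complement is the
  whole grid with a wall along \<open>H\<^sub>1\<close>, which has finitely many holes near the origin. All of this
  grid can be explored. After a rotation by a multiple of a right angle, the wall leads north,
  deviating by at most one column per row.

  The agent first sweeps rows between its two pebbles, moving north and widening the rows by two
  nodes at both ends. As the wall deviates by at most one, the widening rows eventually meet it;
  when they do, the last free row allows the agent to collect both pebbles on a known side of the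
  wall. It climbs beyond the holes and then follows the wall down to its lower end, a fixed node
  that depends on the side only. Now that its position is known, a fixed tour covers any desired
  finite set and places the pebbles in a row below the wall, far to the left and far to the right.
  From each of them, an excursion in a direction flatter than the wall hits the wall above the
  holes and can be retraced. Moving the pebbles outwards and down in each round makes the
  trapezoidal loops formed by the row and the two excursions sweep the rest of the grid.\<close>

section \<open>Compiling blockwise programs\<close>

text \<open>The holes stem from thin complements: near the origin an edge may leap over the whole
  complementary sector and have both ends in the wedge, so that it crosses \<open>H1\<close> without
  being blocked. Further along \<open>H1\<close> the sector is wider than an edge, which bounds the
  stretch with holes. The automaton may depend on the wedge but not on its starting node. Constants
  such as \<open>hi - lo\<close> and whole paths can therefore be built in, but a path is useful
  only from a known node; hence the search has to end at one of two fixed nodes. The wall is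
  infinite upwards, so a loop cannot close around it. It has to pass below the wall and turn back at
  the wall on either side, and the way back must be known without further marks. In the coordinates
  of its side, an excursion stays on a line \<open>x + 2 * y = c\<close> up to its intermediate
  nodes. Moving the pebbles out by three columns and down by one row raises \<open>c\<close> by
  exactly one, so no line is skipped.\<close>

lemma neighbour_opposite: "neighbour (neighbour u d) (opposite d) = u"
  by (cases u; cases d) auto

lemma opposite_opposite: "opposite (opposite d) = d"
  by (cases d) auto

fun walk :: "node \<Rightarrow> port list \<Rightarrow> node" where
  "walk u [] = u"
| "walk u (d # ds) = walk (neighbour u d) ds"

fun free_path :: "(node \<Rightarrow> port \<Rightarrow> bool) \<Rightarrow> node \<Rightarrow> port list \<Rightarrow> bool" where
  "free_path blocked u [] \<longleftrightarrow> True"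
| "free_path blocked u (d # ds) \<longleftrightarrow> \<not> blocked u d \<and> free_path blocked (neighbour u d) ds"

lemma walk_append: "walk u (ds @ es) = walk (walk u ds) es"
  by (induction ds arbitrary: u) auto

lemma free_path_append:
  "free_path blocked u (ds @ es) \<longleftrightarrow> free_path blocked u ds \<and> free_path blocked (walk u ds) es"
  by (induction ds arbitrary: u) auto

instance port :: finite
proof
  have "UNIV = {North, East, South, West}"
    using port.exhaust by blast
  then show "finite (UNIV :: port set)"
    by (metis finite.emptyI finite.insertI)
qed

section \<open>Reachable configurations\<close>

definition reach ::
  "(node \<Rightarrow> port \<Rightarrow> bool) \<Rightarrow> 'q automaton \<Rightarrow> 'q config \<Rightarrow> 'q config \<Rightarrow> bool" where
  "reach blocked A c c' \<longleftrightarrow> (\<exists>n. (step blocked A ^^ n) c = c')"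

lemma reach_refl [simp]: "reach blocked A c c"
  unfolding reach_def by (metis funpow_0)

lemma reach_step: "step blocked A c = c' \<Longrightarrow> reach blocked A c c'"
  unfolding reach_def by (intro exI[of _ 1]) simp

lemma reach_trans [trans]:
  "reach blocked A c c' \<Longrightarrow> reach blocked A c' c'' \<Longrightarrow> reach blocked A c c''"
  unfolding reach_def by (metis funpow_add comp_apply)

type_synonym 'l program = "'l \<Rightarrow> port set \<Rightarrow> bool \<Rightarrow> nat \<Rightarrow> pebble_action \<times> port list \<times> 'l"

text \<open>A program is executed blockwise: at a label, the input is consulted once, and it determines
  a pebble action, a nonempty list of moves, which are made blindly, and the next label. A state
  of the compiled automaton consists of the next label and the moves still to be made before it.\<close>

fun next_move ::
  "'l program \<Rightarrow> 'l \<times> port list \<Rightarrow> port set \<Rightarrow> bool \<Rightarrow> nat \<Rightarrow> ('l \<times> port list) \<times> pebble_action \<times> port"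
where
  "next_move prog (l, d # ds) F b k = ((l, ds), Keep, d)"
| "next_move prog (l, []) F b k =
    (case prog l F b k of (act, ds, l') \<Rightarrow> ((l', tl ds), act, hd ds))"

definition legal :: "port set \<Rightarrow> bool \<Rightarrow> nat \<Rightarrow> pebble_action \<Rightarrow> port \<Rightarrow> bool" where
  "legal F b k act d \<longleftrightarrow> d \<in> F \<and> (act = Drop \<longrightarrow> \<not> b \<and> 0 < k) \<and> (act = Pick \<longrightarrow> b)"

text \<open>Validity is demanded for every nonempty set of ports and every pebble count up to
  \<open>p\<close>, including inputs that never occur. The guard \<open>legal\<close> replaces an
  illegal action by a move through some free port, so that a bound on the block lengths suffices for
  \<open>valid_compile\<close>.\<close>

definition compile_trans ::
  "('l :: finite) program \<Rightarrow> nat \<Rightarrow> port set \<Rightarrow> bool \<Rightarrow> nat \<Rightarrow> nat \<times> pebble_action \<times> port" where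
  "compile_trans prog q F b k =
    (case next_move prog (from_nat q) F b k of (q', act, d) \<Rightarrow>
      if legal F b k act d then (to_nat q', act, d) else (q, Keep, SOME d. d \<in> F))"

definition compile :: "nat \<Rightarrow> ('l :: finite) program \<Rightarrow> 'l \<Rightarrow> nat automaton" where
  "compile N prog l =
    \<lparr>states = to_nat ` {(l :: 'l, ds :: port list). length ds \<le> N}, init
        = to_nat (l, [] :: port list),
     trans = compile_trans prog\<rparr>"

lemma valid_compile:
  fixes prog :: "('l :: finite) program"
  assumes len: "\<And>l F b k. length (fst (snd (prog l F b k))) \<le> N"
  shows "valid_automaton p (compile N prog l)"
proof -
  have "finite ((UNIV :: 'l set) \<times> {ds :: port list. length ds \<le> N})"
    using finite_lists_length_le[of "UNIV :: port set" N] by simp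
  moreover have "{(l :: 'l, ds :: port list). length ds \<le> N} = UNIV \<times> {ds. length ds \<le> N}"
    by auto
  ultimately have fin: "finite {(l :: 'l, ds :: port list). length ds \<le> N}"
    by simp
  have step: "case compile_trans prog q F b k of (q', act, d) \<Rightarrow>
      q' \<in> to_nat ` {(l :: 'l, ds :: port list). length ds \<le> N} \<and> legal F b k act d"
    if q: "q \<in> to_nat ` {(l :: 'l, ds :: port list). length ds \<le> N}" and F: "F \<noteq> {}" for q F b k
  proof -
    obtain l and ds :: "port list" where q_def: "q = to_nat (l :: 'l, ds)" and ds: "length ds \<le> N"
      using q by auto
    obtain l' ds' act d where nm: "next_move prog (l, ds) F b k = ((l', ds'), act, d)"
      by (metis prod.exhaust)
    have "length ds' \<le> N"
    proof (cases ds)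
      case Nil
      then show ?thesis
        using nm len[of l F b k] by (auto split: prod.splits)
    next
      case Cons
      then show ?thesis
        using nm ds by auto
    qed
    moreover have "(SOME d. d \<in> F) \<in> F"
      using F by (simp add: some_in_eq)
    ultimately show ?thesis
      using q nm by (auto simp: compile_trans_def q_def legal_def)
  qed
  show ?thesis
    unfolding valid_automaton_def
  proof (intro conjI ballI allI impI)
    show "finite (states (compile N prog l))" "init (compile N prog l) \<in> states (compile N prog l)"
      using fin by (auto simp: compile_def)
    fix q and F :: "port set" and b k
    assume "q \<in> states (compile N prog l)" and "F \<noteq> {} \<and> k \<le> p"
    then show "case trans (compile N prog l) q F b k of (q', act, d) \<Rightarrow>
        q' \<in> states (compile N prog l) \<and> d \<in> F \<and>
        (act = Drop \<longrightarrow> \<not> b \<and> 0 < k) \<and> (act = Pick \<longrightarrow> b)"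
      using step[of q F b k] by (auto simp: compile_def legal_def split: prod.splits)
  qed
qed

definition config_at :: "('l :: finite) \<Rightarrow> port list \<Rightarrow> node \<Rightarrow> node set \<Rightarrow> nat \<Rightarrow> nat config" where
  "config_at l ds u B k = \<lparr>state = to_nat (l, ds), position = u, pebbles = B, carried = k\<rparr>"

abbreviation at_label :: "('l :: finite) \<Rightarrow> node \<Rightarrow> node set \<Rightarrow> nat \<Rightarrow> nat config" where
  "at_label l \<equiv> config_at l []"

lemma position_config_at [simp]: "position (config_at l ds u B k) = u"
  by (simp add: config_at_def)

lemma start_compile: "start p (compile N prog l) s = at_label l s {} p"
  by (simp add: start_def compile_def config_at_def)

fun new_pebbles :: "pebble_action \<Rightarrow> node \<Rightarrow> node set \<Rightarrow> node set" where
  "new_pebbles Keep u B = B"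
| "new_pebbles Drop u B = insert u B"
| "new_pebbles Pick u B = B - {u}"

fun new_carried :: "pebble_action \<Rightarrow> nat \<Rightarrow> nat" where
  "new_carried Keep k = k"
| "new_carried Drop k = k - 1"
| "new_carried Pick k = k + 1"

lemma step_compile:
  fixes prog :: "('l :: finite) program"
  assumes "next_move prog (l, ds) {d. \<not> blocked u d} (u \<in> B) k = ((l', ds'), act, d)"
    and "legal {d. \<not> blocked u d} (u \<in> B) k act d"
  shows "step blocked (compile N prog l0) (config_at l ds u B k) =
    config_at l' ds' (neighbour u d) (new_pebbles act u B) (new_carried act k)"
  using assms
  by (cases act) (simp_all add: step_def compile_def compile_trans_def config_at_def)

lemma reach_moves:
  fixes prog :: "('l :: finite) program" and l :: 'l
  assumes "free_path blocked u (ds @ es)"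
  shows "reach blocked (compile N prog l0) (config_at l (ds @ es) u B k)
      (config_at l es (walk u ds) B k)"
  using assms
proof (induction ds arbitrary: u)
  case (Cons d ds)
  have "step blocked (compile N prog l0) (config_at l (d # ds @ es) u B k) =
      config_at l (ds @ es) (neighbour u d) (new_pebbles Keep u B) (new_carried Keep k)"
    using Cons.prems by (intro step_compile) (auto simp: legal_def)
  then show ?case
    using reach_trans[OF reach_step Cons.IH[of "neighbour u d"]] Cons.prems by simp
qed simp

definition block ::
  "(node \<Rightarrow> port \<Rightarrow> bool) \<Rightarrow> 'l program \<Rightarrow> 'l \<Rightarrow> node \<Rightarrow> node set \<Rightarrow> nat \<Rightarrow>
    'l \<Rightarrow> node \<Rightarrow> node set \<Rightarrow> nat \<Rightarrow> bool" where
  "block blocked prog l u B k l' u' B' k' \<longleftrightarrow>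
    (case prog l {d. \<not> blocked u d} (u \<in> B) k of (act, ds, l'') \<Rightarrow>
      ds \<noteq> [] \<and> (act = Drop \<longrightarrow> u \<notin> B \<and> 0 < k) \<and> (act = Pick \<longrightarrow> u \<in> B) \<and> free_path blocked u ds \<and>
      l' = l'' \<and> u' = walk u ds \<and> B' = new_pebbles act u B \<and> k' = new_carried act k)"

text \<open>Nodes in the midst of a block are visited too; this is how a single blind tour covers a
  finite set. The prefix is nonempty because the pebble action is performed together with the first
  move.\<close>

lemma reach_prefix:
  fixes prog :: "('l :: finite) program"
  assumes prog: "prog l {d. \<not> blocked u d} (u \<in> B) k = (act, ds, l')"
    and act: "act = Drop \<longrightarrow> u \<notin> B \<and> 0 < k" "act = Pick \<longrightarrow> u \<in> B"
    and path: "free_path blocked u ds" and ds: "ds = ds1 @ ds2" "ds1 \<noteq> []"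
  shows "reach blocked (compile N prog l0) (at_label l u B k)
    (config_at l' ds2 (walk u ds1) (new_pebbles act u B) (new_carried act k))"
proof -
  obtain d es where d: "ds1 = d # es"
    using ds(2) by (cases ds1) auto
  have "step blocked (compile N prog l0) (at_label l u B k) =
    config_at l' (es @ ds2) (neighbour u d) (new_pebbles act u B) (new_carried act k)"
    using prog act path ds d by (intro step_compile) (auto simp: legal_def)
  moreover have "free_path blocked (neighbour u d) (es @ ds2)"
    using path ds d by simp
  ultimately show ?thesis
    using reach_trans[OF reach_step reach_moves] d by simp
qed

lemma reach_block:
  fixes prog :: "('l :: finite) program"
  assumes "block blocked prog l u B k l' u' B' k'"
  shows "reach blocked (compile N prog l0) (at_label l u B k) (at_label l' u' B' k')"
proof -
  obtain act ds where p: "prog l {d. \<not> blocked u d} (u \<in> B) k = (act, ds, l')" and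
    rest: "ds \<noteq> []" "act = Drop \<longrightarrow> u \<notin> B \<and> 0 < k" "act = Pick \<longrightarrow> u \<in> B" "free_path blocked u ds"
      "u' = walk u ds" "B' = new_pebbles act u B" "k' = new_carried act k"
    using assms unfolding block_def by (auto split: prod.splits)
  show ?thesis
    using reach_prefix[of prog, OF p rest(2,3,4), of ds "[]"] rest by simp
qed

section \<open>The automaton\<close>

definition inward :: "bool \<Rightarrow> port" where
  "inward s = (if s then West else East)"

definition outward :: "bool \<Rightarrow> port" where
  "outward s = (if s then East else West)"

text \<open>Labels with a Boolean argument occur on both sides of the wall, \<open>True\<close> being the right one.\<close>

datatype label =
    Start
  | Grow_right1 | Grow_right2 | Grow_right3
  | Sweep_left
  | Grow_left1 | Grow_left2 | Grow_left3
  | Sweep_right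
  | Back_left | Gather_right_low | Gather_right_high | Gather_left
  | To_wall bool
  | Down1 bool | Down2 bool | Down3 bool
  | Deploy
  | Put_right | Put_left
  | Row_left | Row_right
  | Out0 bool | Out1 bool | Out2 bool
  | Return bool

instance label :: finite
proof
  have "UNIV \<subseteq> {Start, Grow_right1, Grow_right2, Grow_right3, Sweep_left, Grow_left1, Grow_left2,
      Grow_left3, Sweep_right, Back_left, Gather_right_low, Gather_right_high, Gather_left, Deploy,
      Put_right, Put_left, Row_left, Row_right} \<union>
    (\<Union>f\<in>{To_wall, Down1, Down2, Down3, Out0, Out1, Out2, Return}. range f)" (is "_ \<subseteq> ?L")
  proof
    fix l
    show "l \<in> ?L"
      by (cases l) auto
  qed
  then show "finite (UNIV :: label set)"
    by (rule finite_subset) simp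
qed

text \<open>Outward comes before North, since the wall of the next row may be one column closer to
  the agent.\<close>

definition climb :: "nat \<Rightarrow> bool \<Rightarrow> port list" where
  "climb n s = concat (replicate n [outward s, North])"

text \<open>The labels \<open>Down1\<close> to \<open>Down3\<close> count the columns tested in one
  row. \<open>Out1\<close>, \<open>Out2\<close> and \<open>Out0\<close> record how far the agent is
  from the last node to which \<open>Return\<close> applies, hence which moves lead back when a port
  is blocked.\<close>

fun plan :: "nat \<Rightarrow> (bool \<Rightarrow> port list) \<Rightarrow> port list \<Rightarrow> label program" where
  "plan n tour deploy Start F b k =
    (if East \<in> F then (Drop, [East], Grow_right1) else (Keep, climb n False, To_wall False))"
| "plan n tour deploy Grow_right1 F b k =
    (if East \<in> F then (Keep, [East], Grow_right2) else (Keep, [West], Gather_left))"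
| "plan n tour deploy Grow_right2 F b k =
    (if North \<in> F then (Keep, [North], Grow_right3) else (Keep, [West], Gather_left))"
| "plan n tour deploy Grow_right3 F b k = (Drop, [South, West], Sweep_left)"
| "plan n tour deploy Sweep_left F b k =
    (if \<not> b then (Keep, [West], Sweep_left)
     else if West \<in> F then (Pick, [West], Grow_left1) else (Pick, [East], Gather_right_low))"
| "plan n tour deploy Grow_left1 F b k =
    (if West \<in> F then (Keep, [West], Grow_left2) else (Keep, [East], Gather_right_low))"
| "plan n tour deploy Grow_left2 F b k =
    (if North \<in> F then (Keep, [North], Grow_left3) else (Keep, [East], Gather_right_low))"
| "plan n tour deploy Grow_left3 F b k =
    (if East \<in> F then (Drop, [East], Sweep_right) else (Keep, [South, East], Gather_right_low))"
| "plan n tour deploy Sweep_right F b k =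
    (if b then if East \<in> F then (Pick, [East], Grow_right1) else (Pick, [West], Gather_left)
     else if East \<in> F then (Keep, [East], Sweep_right) else (Keep, [West], Back_left))"
| "plan n tour deploy Back_left F b k =
    (if b then (Pick, [South, East], Gather_right_low) else (Keep, [West], Back_left))"
| "plan n tour deploy Gather_right_low F b k =
    (if North \<in> F then (Keep, [North], Gather_right_high) else (Keep, [East], Gather_right_low))"
| "plan n tour deploy Gather_right_high F b k =
    (if b then (Pick, climb n True, To_wall True) else (Keep, [South, East], Gather_right_low))"
| "plan n tour deploy Gather_left F b k =
    (if b then (Pick, climb n False, To_wall False) else (Keep, [West], Gather_left))"
| "plan n tour deploy (To_wall s) F b k =
    (if inward s \<in> F then (Keep, [inward s], To_wall s) else (Keep, [outward s, South], Down1 s))"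
| "plan n tour deploy (Down1 s) F b k =
    (if inward s \<in> F then (Keep, [inward s], Down2 s) else (Keep, [outward s, South], Down1 s))"
| "plan n tour deploy (Down2 s) F b k =
    (if inward s \<in> F then (Keep, [inward s], Down3 s) else (Keep, [outward s, South], Down1 s))"
| "plan n tour deploy (Down3 s) F b k =
    (if inward s \<in> F then (Keep, tour s, Deploy) else (Keep, [outward s, South], Down1 s))"
| "plan n tour deploy Deploy F b k = (Drop, deploy, Put_right)"
| "plan n tour deploy Put_right F b k = (Drop, [North], Out1 True)"
| "plan n tour deploy (Out1 s) F b k =
    (if inward s \<in> F then (Keep, [inward s], Out2 s) else (Keep, [South], Return s))"
| "plan n tour deploy (Out2 s) F b k =
    (if inward s \<in> F then (Keep, [inward s], Out0 s) else (Keep, [outward s, South], Return s))"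
| "plan n tour deploy (Out0 s) F b k =
    (if North \<in> F then (Keep, [North], Out1 s)
     else (Keep, [outward s, outward s, South], Return s))"
| "plan n tour deploy (Return s) F b k =
    (if \<not> b then (Keep, [outward s, outward s, South], Return s)
     else if s then (Keep, [West], Row_left) else (Pick, [West, West, West, South], Put_left))"
| "plan n tour deploy Row_left F b k =
    (if b then (Keep, [North], Out1 False) else (Keep, [West], Row_left))"
| "plan n tour deploy Put_left F b k = (Drop, [North, East, East, East, East], Row_right)"
| "plan n tour deploy Row_right F b k =
    (if b then (Pick, [East, East, East, South], Put_right) else (Keep, [East], Row_right))"

lemma length_climb: "length (climb n s) = 2 * n"
  by (induction n) (auto simp: climb_def)

lemma length_plan:
  "length (fst (snd (plan n tour deploy l F b k))) \<le>
    5 + 2 * n + length (tour True) + length (tour False) + length deploy"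
proof -
  have "length (tour s) \<le>
      5 + 2 * n + length (tour True) + length (tour False) + length deploy" for s
    by (cases s) auto
  then show ?thesis
    by (cases l) (auto simp: length_climb)
qed

text \<open>The (idealised) wall meets each row \<open>y\<close> between \<open>w y - 1\<close> and \<open>w y\<close>. The actual wall
  begins somewhere in the rows from \<open>lo\<close> to \<open>hi\<close>, where it may have holes.\<close>

locale wall =
  fixes blocked :: "node \<Rightarrow> port \<Rightarrow> bool" and w :: "int \<Rightarrow> int" and lo hi :: int
  assumes blocked_West: "blocked (x, y) West \<longleftrightarrow> blocked (x - 1, y) East"
    and blocked_South: "blocked (x, y) South \<longleftrightarrow> blocked (x, y - 1) North"
    and East_imp: "blocked (x, y) East \<Longrightarrow> x + 1 = w y \<and> lo \<le> y"
    and North_imp: "blocked (x, y) North \<Longrightarrow> (w y \<le> x) \<noteq> (w (y + 1) \<le> x) \<and> lo \<le> y"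
    and blocked_East: "hi \<le> y \<Longrightarrow> blocked (w y - 1, y) East"
    and blocked_North: "hi \<le> y \<Longrightarrow> (w y \<le> x) \<noteq> (w (y + 1) \<le> x) \<Longrightarrow> blocked (x, y) North"
    and lipschitz: "\<bar>w (y + 1) - w y\<bar> \<le> 1"
    and lo_le_hi: "lo \<le> hi"
begin

lemma lipschitz_diff: "\<bar>w y - w z\<bar> \<le> \<bar>y - z\<bar>"
proof -
  have "\<bar>w (z + int n) - w z\<bar> \<le> int n" for z n
  proof (induction n)
    case (Suc n)
    then show ?case
      using lipschitz[of "z + int n"] by (auto simp: algebra_simps)
  qed simp
  from this[of y "nat (z - y)"] this[of z "nat (y - z)"] show ?thesis
    by (cases "y \<le> z") auto
qed

text \<open>Mirrored coordinates, in which the side \<open>s\<close> always lies to the right of the wall \<open>wall_at s\<close>.\<close>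

definition mirror :: "bool \<Rightarrow> int \<Rightarrow> int \<Rightarrow> node" where
  "mirror s x y = (if s then x else - x, y)"

text \<open>The last node left of the wall has column \<open>w y - 1\<close>, which becomes
  \<open>1 - w y\<close> in the mirrored coordinates.\<close>

definition wall_at :: "bool \<Rightarrow> int \<Rightarrow> int" where
  "wall_at s y = (if s then w y else 1 - w y)"

lemma neighbour_mirror [simp]:
  "neighbour (mirror s x y) (inward s) = mirror s (x - 1) y"
  "neighbour (mirror s x y) (outward s) = mirror s (x + 1) y"
  "neighbour (mirror s x y) North = mirror s x (y + 1)"
  "neighbour (mirror s x y) South = mirror s x (y - 1)"
  by (auto simp: mirror_def inward_def outward_def)

lemma mirror_eq_iff [simp]: "mirror s x y = mirror s x' y' \<longleftrightarrow> x = x' \<and> y = y'"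
  by (auto simp: mirror_def)

lemma blocked_outward: "blocked (mirror s x y) (outward s) \<longleftrightarrow>
    blocked (mirror s (x + 1) y) (inward s)"
  by (auto simp: mirror_def inward_def outward_def blocked_West)

lemma mirror_South: "blocked (mirror s x y) South \<longleftrightarrow> blocked (mirror s x (y - 1)) North"
  by (auto simp: mirror_def blocked_South)

lemma inward_imp: "blocked (mirror s x y) (inward s) \<Longrightarrow> x = wall_at s y \<and> lo \<le> y"
  using East_imp[of "x - 1" y] East_imp[of "- x" y]
  by (auto simp: mirror_def inward_def wall_at_def blocked_West split: if_splits)

lemma mirror_North_imp:
  "blocked (mirror s x y) North \<Longrightarrow> (wall_at s y \<le> x) \<noteq> (wall_at s (y + 1) \<le> x) \<and> lo \<le> y"
  using North_imp[of x y] North_imp[of "- x" y]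
  by (auto simp: mirror_def wall_at_def split: if_splits)

lemma blocked_inward: "hi \<le> y \<Longrightarrow> blocked (mirror s (wall_at s y) y) (inward s)"
  using blocked_East[of y] by (auto simp: mirror_def inward_def wall_at_def blocked_West)

lemma blocked_mirror_North:
  "hi \<le> y \<Longrightarrow> (wall_at s y \<le> x) \<noteq> (wall_at s (y + 1) \<le> x) \<Longrightarrow> blocked (mirror s x y) North"
  using blocked_North[of y x] blocked_North[of y "- x"]
  by (auto simp: mirror_def wall_at_def split: if_splits)

lemma wall_at_diff: "\<bar>wall_at s y - wall_at s z\<bar> \<le> \<bar>y - z\<bar>"
  using lipschitz_diff[of y z] by (auto simp: wall_at_def)

lemma wall_at_step: "wall_at s (y + 1) \<le> wall_at s y + 1" "wall_at s y \<le> wall_at s (y + 1) + 1"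
    "wall_at s (y - 1) \<le> wall_at s y + 1" "wall_at s y \<le> wall_at s (y - 1) + 1"
  using wall_at_diff[of s "y + 1" y] wall_at_diff[of s "y - 1" y] by auto

lemma not_blocked_inward:
  "wall_at s y < x \<Longrightarrow> \<not> blocked (mirror s x y) (inward s)"
  using inward_imp[of s x y] by auto

lemma not_blocked_North:
  "wall_at s y \<le> x \<Longrightarrow> wall_at s (y + 1) \<le> x \<Longrightarrow> \<not> blocked (mirror s x y) North"
  using mirror_North_imp[of s x y] by auto

lemma free_path_climb:
  "wall_at s y \<le> x \<Longrightarrow> free_path blocked (mirror s x y) (climb n s) \<and>
     walk (mirror s x y) (climb n s) = mirror s (x + int n) (y + int n)"
proof (induction n arbitrary: x y)
  case (Suc n)
  have "free_path blocked (mirror s (x + 1) (y + 1)) (climb n s) \<and>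
     walk (mirror s (x + 1) (y + 1)) (climb n s) = mirror s (x + 1 + int n) (y + 1 + int n)"
    using Suc.prems wall_at_step(1)[of s y] by (intro Suc.IH) simp
  then show ?case
    using Suc.prems wall_at_step(1)[of s y] not_blocked_inward[of s y "x + 1"]
      not_blocked_North[of s y "x + 1"]
    by (simp add: climb_def blocked_outward algebra_simps)
qed (simp add: climb_def)

section \<open>Connectivity of the grid with the wall\<close>

definition connected_nodes :: "node \<Rightarrow> node \<Rightarrow> bool" where
  "connected_nodes u v \<longleftrightarrow> (\<exists>ds. free_path blocked u ds \<and> walk u ds = v)"

lemma connected_refl: "connected_nodes u u"
  unfolding connected_nodes_def by (intro exI[of _ "[]"]) simp

lemma connected_trans: "connected_nodes u v \<Longrightarrow> connected_nodes v z \<Longrightarrow> connected_nodes u z"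
  unfolding connected_nodes_def by (metis free_path_append walk_append)

lemma blocked_opposite: "blocked (neighbour u d) (opposite d) \<longleftrightarrow> blocked u d"
  using blocked_West blocked_South by (cases u; cases d) auto

lemma connected_sym: "connected_nodes u v \<Longrightarrow> connected_nodes v u"
proof -
  have "\<exists>es. free_path blocked (walk u ds) es \<and> walk (walk u ds) es = u"
      if "free_path blocked u ds" for u ds
    using that
  proof (induction ds arbitrary: u)
    case Nil
    show ?case
      by (intro exI[of _ "[]"]) simp
  next
    case (Cons d ds)
    from Cons.IH[of "neighbour u d"] Cons.prems
    obtain es where "free_path blocked (walk (neighbour u d) ds) es"
        "walk (walk (neighbour u d) ds) es = neighbour u d"
      by (metis free_path.simps(2))
    then show ?case
      using Cons.prems
      by (intro exI[of _ "es @ [opposite d]"])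
        (simp add: free_path_append walk_append blocked_opposite neighbour_opposite)
  qed
  then show "connected_nodes u v \<Longrightarrow> connected_nodes v u"
    unfolding connected_nodes_def by metis
qed

lemma connected_step: "\<not> blocked u d \<Longrightarrow> connected_nodes u (neighbour u d)"
  unfolding connected_nodes_def by (intro exI[of _ "[d]"]) simp

lemma connected_low_row: "y < lo \<Longrightarrow> connected_nodes (x, y) (0, y)"
proof -
  assume y: "y < lo"
  have "connected_nodes (0, y) (int n, y)" for n
  proof (induction n)
    case (Suc n)
    have "\<not> blocked (int n, y) East"
      using y East_imp[of "int n" y] by auto
    then show ?case
      using connected_trans[OF Suc connected_step[of "(int n, y)" East]] by (simp add: add.commute)
  qed (simp add: connected_refl)
  moreover have "connected_nodes (0, y) (- int n, y)" for n
  proof (induction n)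
    case (Suc n)
    have "\<not> blocked (- int n, y) West"
      using y East_imp[of "- int n - 1" y] by (auto simp: blocked_West)
    then have "connected_nodes (0, y) (- int n - 1, y)"
      using connected_trans[OF Suc connected_step[of "(- int n, y)" West]] by simp
    moreover have "- int (Suc n) = - int n - 1"
      by simp
    ultimately show ?case
      by metis
  qed (simp add: connected_refl)
  ultimately have "connected_nodes (0, y) (x, y)"
    by (cases x rule: int_cases2) simp_all
  then show ?thesis
    by (rule connected_sym)
qed

lemma connected_low: "y < lo \<Longrightarrow> connected_nodes (x, y) (0, lo - 1)"
proof -
  have "connected_nodes (0, lo - 1 - int n) (0, lo - 1)" for n
  proof (induction n)
    case (Suc n)
    have "\<not> blocked (0, lo - 1 - int (Suc n)) North"
      using North_imp[of 0 "lo - 1 - int (Suc n)"] by auto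
    then show ?case
      using connected_trans[OF connected_step[of "(0, lo - 1 - int (Suc n))" North]] Suc
      by (simp add: algebra_simps)
  qed (simp add: connected_refl)
  from this[of "nat (lo - 1 - y)"] have "y < lo \<Longrightarrow> connected_nodes (0, y) (0, lo - 1)"
    by simp
  then show "y < lo \<Longrightarrow> ?thesis"
    using connected_low_row[of y x] by (blast intro: connected_trans)
qed

text \<open>Going outward before going down stays on the same side, as the wall shifts by at most
  one column per row. In this way every node is joined to the unobstructed rows below
  \<open>lo\<close>.\<close>

lemma connected_side: "wall_at s y \<le> x \<Longrightarrow>
    connected_nodes (mirror s x y) (mirror s (x + int n) (y - int n))"
proof (induction n)
  case (Suc n)
  let ?x = "x + int n" and ?y = "y - int n"
  have "wall_at s ?y \<le> ?x"
    using Suc.prems wall_at_diff[of s ?y y] by auto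
  moreover have "wall_at s (?y - 1) \<le> ?x + 1"
    using calculation wall_at_step(3)[of s ?y] by linarith
  ultimately have "\<not> blocked (mirror s ?x ?y) (outward s)" "\<not> blocked (mirror s (?x + 1) ?y) South"
    using not_blocked_inward[of s ?y "?x + 1"] not_blocked_North[of s "?y - 1" "?x + 1"]
    by (auto simp: blocked_outward mirror_South)
  then have "connected_nodes (mirror s ?x ?y) (mirror s (?x + 1) (?y - 1))"
    using connected_trans[OF connected_step[of "mirror s ?x ?y"
      "outward s"] connected_step[of _ South]]
    by simp
  then show ?case
    using connected_trans[OF Suc.IH[OF Suc.prems]] by (simp add: algebra_simps)
qed (simp add: connected_refl)

lemma mirror_cases:
  obtains s x y where "u = mirror s x y" and "wall_at s y \<le> x"
proof (cases u)
  case (Pair x y)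
  then show ?thesis
    using that[of True x y] that[of False "- x" y]
    by (cases "w y \<le> x") (auto simp: mirror_def wall_at_def)
qed

lemma connected: "connected_nodes u v"
proof -
  have "connected_nodes u (0, lo - 1)" for u
  proof (cases rule: mirror_cases[of u])
    case (1 s x y)
    define n where "n = nat (y - lo + 1)"
    obtain x' where x': "mirror s (x + int n) (y - int n) = (x', y - int n)"
      by (simp add: mirror_def)
    have "y - int n < lo"
      by (simp add: n_def)
    then have "connected_nodes (x', y - int n) (0, lo - 1)"
      by (rule connected_low)
    then show ?thesis
      using connected_trans[OF connected_side[OF 1(2), of n]] x' 1(1) by simp
  qed
  then show ?thesis
    using connected_trans[OF _ connected_sym] by blast
qed

text \<open>The nonempty prefixes are those that \<open>reach_prefix\<close> asks for. The induction
  runs over all starting nodes, because each node visited is the start of the remaining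
  tour.\<close>

lemma tour_exists:
  assumes "finite X"
  shows "\<exists>ds. ds \<noteq> [] \<and> free_path blocked u ds \<and> walk u ds = v \<and>
    (\<forall>x\<in>X. \<exists>ds1 ds2. ds = ds1 @ ds2 \<and> ds1 \<noteq> [] \<and> walk u ds1 = x)"
  using assms
proof (induction X arbitrary: u)
  case empty
  \<comment> \<open>The detour through the node north of \<open>v\<close> makes the path nonempty
    even if \<open>u = v\<close>.\<close>
  obtain es where es: "free_path blocked u es" "walk u es = neighbour v North"
    using connected[of u "neighbour v North"] unfolding connected_nodes_def by blast
  obtain fs where fs: "free_path blocked (neighbour v North) fs" "walk (neighbour v North) fs = v"
    using connected[of "neighbour v North" v] unfolding connected_nodes_def by blast
  have "fs \<noteq> []"
    using fs(2) by (cases v) auto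
  then show ?case
    using es fs by (intro exI[of _ "es @ fs"]) (simp add: free_path_append walk_append)
next
  case (insert x X)
  obtain a b where u: "u = (a, b)"
    by (cases u)
  \<comment> \<open>A row has at most one blocked horizontal edge, so a first move exists. It makes
    the prefix up to \<open>x\<close> nonempty even if \<open>x = u\<close>.\<close>
  have "\<not> blocked u East \<or> \<not> blocked u West"
    using East_imp[of a b] East_imp[of "a - 1" b] by (auto simp: u blocked_West)
  then obtain d where d: "\<not> blocked u d"
    by blast
  obtain es where es: "free_path blocked (neighbour u d) es" "walk (neighbour u d) es = x"
    using connected[of "neighbour u d" x] unfolding connected_nodes_def by blast
  obtain fs where fs: "free_path blocked x fs" "walk x fs = v"
      and X: "\<And>z. z \<in> X \<Longrightarrow> \<exists>ds1 ds2. fs = ds1 @ ds2 \<and> ds1 \<noteq> [] \<and> walk x ds1 = z"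
    using insert.IH[of x] by metis
  let ?ds = "d # es @ fs"
  have "\<exists>ds1 ds2. ?ds = ds1 @ ds2 \<and> ds1 \<noteq> [] \<and> walk u ds1 = z" if "z \<in> insert x X" for z
  proof (cases "z = x")
    case True
    then show ?thesis
      using es by (intro exI[of _ "d # es"] exI[of _ fs]) auto
  next
    case False
    with that have "z \<in> X"
      by simp
    from X[OF this] obtain ds1 ds2 where "fs = ds1 @ ds2" "walk x ds1 = z"
      by blast
    then show ?thesis
      using es by (intro exI[of _ "d # es @ ds1"] exI[of _ ds2]) (auto simp: walk_append)
  qed
  then have "\<forall>z\<in>insert x X. \<exists>ds1 ds2. ?ds = ds1 @ ds2 \<and> ds1 \<noteq> [] \<and> walk u ds1 = z"
    by blast
  moreover have "?ds \<noteq> []" "free_path blocked u ?ds" "walk u ?ds = v"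
    using d es fs by (simp_all add: free_path_append walk_append)
  ultimately show ?case
    by blast
qed

end

section \<open>Finding the wall\<close>

lemma reach_iterate:
  "(\<And>i. i < n \<Longrightarrow> reach blocked A (c i) (c (Suc i))) \<Longrightarrow> reach blocked A (c 0) (c n)"
proof (induction n)
  case (Suc n)
  then show ?case
    using reach_trans[of blocked A "c 0" "c n"] by simp
qed simp

locale wall_agent = wall +
  fixes tour :: "bool \<Rightarrow> port list" and deploy :: "port list" and N :: nat
begin

abbreviation "prog \<equiv> plan (Suc (nat (hi - lo))) tour deploy"

abbreviation reaches :: "nat config \<Rightarrow> nat config \<Rightarrow> bool" where
  "reaches \<equiv> reach blocked (compile N prog Start)"

lemma reaches_block: "block blocked prog l u B k l' u' B' k' \<Longrightarrow> reaches (at_label l u B k)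
    (at_label l' u' B' k')"
  by (rule reach_block)

lemma inward_loop:
  assumes "a \<le> x"
    and step: "\<And>i. a < i \<Longrightarrow> i \<le> x \<Longrightarrow> \<not> blocked (mirror s i y) (inward s) \<and>
      prog l {d. \<not> blocked (mirror s i y) d} (mirror s i y \<in> B) k = (Keep, [inward s], l)"
  shows "reaches (at_label l (mirror s x y) B k) (at_label l (mirror s a y) B k)"
proof -
  let ?c = "\<lambda>i. at_label l (mirror s (x - int i) y) B k"
  have "reaches (?c 0) (?c (nat (x - a)))"
  proof (rule reach_iterate)
    fix i
    assume "i < nat (x - a)"
    then have "a < x - int i" "x - int i \<le> x"
      by auto
    from step[OF this] show "reaches (?c i) (?c (Suc i))"
      by (intro reaches_block) (simp add: block_def algebra_simps)
  qed
  then show ?thesis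
    using assms(1) by simp
qed

lemma West_loop:
  assumes "a \<le> x"
    and "\<And>F. West \<in> F \<Longrightarrow> prog l F False k = (Keep, [West], l)"
    and "\<And>i. a < i \<Longrightarrow> i \<le> x \<Longrightarrow> (i, y) \<notin> B \<and> \<not> blocked (i - 1, y) East"
  shows "reaches (at_label l (x, y) B k) (at_label l (a, y) B k)"
  using inward_loop[of a x True y l B k] assms by (simp add: mirror_def inward_def blocked_West)

lemma East_loop:
  assumes "x \<le> b"
    and "\<And>F. East \<in> F \<Longrightarrow> prog l F False k = (Keep, [East], l)"
    and "\<And>i. x \<le> i \<Longrightarrow> i < b \<Longrightarrow> (i, y) \<notin> B \<and> \<not> blocked (i, y) East"
  shows "reaches (at_label l (x, y) B k) (at_label l (b, y) B k)"
proof -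
  have "(- i, y) \<notin> B \<and> \<not> blocked (- i, y) East" if "- b < i" "i \<le> - x" for i
    using assms(3)[of "- i"] that by auto
  then show ?thesis
    using inward_loop[of "- b" "- x" False y l B k] assms(1,2) by (simp add: mirror_def inward_def)
qed

section \<open>Widening rows and the recovery of both pebbles\<close>

definition row_free :: "int \<Rightarrow> int \<Rightarrow> int \<Rightarrow> bool" where
  "row_free a b y \<longleftrightarrow> (\<forall>x. a \<le> x \<and> x < b \<longrightarrow> \<not> blocked (x, y) East)"

definition finds_wall :: "nat config \<Rightarrow> bool" where
  "finds_wall c \<longleftrightarrow> (\<exists>s x y. hi \<le> y \<and> wall_at s y \<le> x \<and> reaches c
    (at_label (To_wall s) (mirror s x y) {} 2))"

lemma finds_wall_trans: "reaches c c' \<Longrightarrow> finds_wall c' \<Longrightarrow> finds_wall c"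
  unfolding finds_wall_def by (meson reach_trans)

lemma finds_wall_block:
  "finds_wall (at_label l' u' B' k') \<Longrightarrow> block blocked prog l u B k l' u' B' k' \<Longrightarrow> finds_wall
    (at_label l u B k)"
  using finds_wall_trans reaches_block by blast

text \<open>From row \<open>lo\<close> or above, more than \<open>hi - lo\<close> rows lead past all
  holes, and a climb outward at 45 degrees keeps to its side. Up there a walk inward is certain to
  be stopped by the wall.\<close>

lemma finds_wall_climb:
  assumes "lo \<le> y" "wall_at s y \<le> x"
    and "reaches c
        (at_label (To_wall s) (walk (mirror s x y) (climb (Suc (nat (hi - lo))) s)) {} 2)"
  shows "finds_wall c"
proof -
  let ?n = "Suc (nat (hi - lo))"
  have "hi \<le> y + int ?n" "wall_at s (y + int ?n) \<le> x + int ?n"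
    using assms(1,2) wall_at_diff[of s "y + int ?n" y] by auto
  then show ?thesis
    using assms(3) conjunct2[OF
      free_path_climb[OF assms(2), of ?n]] unfolding finds_wall_def by metis
qed

lemma climb_Suc_neq_Nil: "climb (Suc n) s \<noteq> []"
  by (simp add: climb_def)

lemma gather_left:
  assumes "a \<le> x" "a < w y" "lo \<le> y" "row_free a x y"
  shows "finds_wall (at_label Gather_left (x, y) {(a, y)} 1)"
proof -
  have "reaches (at_label Gather_left (x, y) {(a, y)} 1) (at_label Gather_left (a, y) {(a, y)} 1)"
    using assms by (intro West_loop) (auto simp: row_free_def)
  also have "reaches (at_label Gather_left (a, y) {(a, y)} 1)
      (at_label (To_wall False) (walk (mirror False (- a) y) (climb (Suc (nat
        (hi - lo))) False)) {} 2)"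
    using assms free_path_climb[of False y "- a"] climb_Suc_neq_Nil
    by (intro reaches_block) (simp add: block_def wall_at_def mirror_def)
  finally show ?thesis
    using assms by (intro finds_wall_climb[of y False "- a"]) (auto simp: wall_at_def)
qed

text \<open>The right pebble lies one row higher, and the wall may cut that row between the agent
  and the pebble. The agent therefore keeps to the lower row, which is free, and looks for the
  pebble by stepping up and down wherever the North port is free.\<close>

lemma gather_right:
  assumes "w (y + 1) \<le> b" "lo \<le> y + 1" "\<not> blocked (b, y) North"
  shows "x \<le> b \<Longrightarrow> row_free x b y \<Longrightarrow> finds_wall (at_label Gather_right_low (x, y) {(b, y + 1)} 1)"
proof (induction "nat (b - x)" arbitrary: x)
  case 0
  then have "x = b"
    by simp
  have "reaches (at_label Gather_right_low (b, y) {(b, y + 1)} 1)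
      (at_label Gather_right_high (b, y + 1) {(b, y + 1)} 1)"
    using assms by (intro reaches_block) (simp add: block_def)
  also have "reaches (at_label Gather_right_high (b, y + 1) {(b, y + 1)} 1)
      (at_label (To_wall True) (walk (mirror True b (y + 1)) (climb (Suc (nat
        (hi - lo))) True)) {} 2)"
    using assms free_path_climb[of True "y + 1" b] climb_Suc_neq_Nil
    by (intro reaches_block) (simp add: block_def wall_at_def mirror_def)
  finally show ?case
    using assms \<open>x = b\<close> by (intro finds_wall_climb[of "y + 1" True b]) (auto simp: wall_at_def)
next
  case (Suc n)
  then have x: "x < b" "\<not> blocked (x, y) East"
    by (auto simp: row_free_def)
  have IH: "finds_wall (at_label Gather_right_low (x + 1, y) {(b, y + 1)} 1)"
    using Suc x by (intro Suc.hyps(1)) (auto simp: row_free_def)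
  show ?case
  proof (cases "blocked (x, y) North")
    case True
    then show ?thesis
      using x by (intro finds_wall_block[OF IH]) (simp add: block_def)
  next
    case False
    have "reaches (at_label Gather_right_low (x, y) {(b, y + 1)} 1)
        (at_label Gather_right_high (x, y + 1) {(b, y + 1)} 1)"
      using False by (intro reaches_block) (simp add: block_def)
    moreover have "finds_wall (at_label Gather_right_high (x, y + 1) {(b, y + 1)} 1)"
      using False x by (intro finds_wall_block[OF IH]) (simp add: block_def blocked_South)
    ultimately show ?thesis
      by (rule finds_wall_trans)
  qed
qed

text \<open>The right pebble is put into the new row before the left one is fetched, so the way to
  the left end uses the old row, known to be free. If the new row turns out to be cut, the old row
  again gives access to the right pebble.\<close>

lemma sweep_round:
  assumes "a < b" "row_free a b y"
  shows "finds_wall (at_label Grow_right1 (b, y) {(a, y)} 1) \<or>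
    reaches (at_label Grow_right1 (b, y) {(a, y)} 1)
        (at_label Grow_right1 (b + 2, y + 1) {(a - 2, y + 1)} 1) \<and>
    row_free (a - 2) (b + 2) (y + 1)"
\<comment> \<open>As long as the wall is not found, every port tested in the round must be free: a
  blocked one leads to a configuration from which both pebbles are gathered. The facts
  \<open>1\<close> to \<open>7\<close> and \<open>free\<close> are all obtained in this way.\<close>
proof (subst disj_imp, rule impI)
  let ?c = "at_label Grow_right1 (b, y) {(a, y)} 1"
  assume lost: "\<not> finds_wall ?c"
  note lostI = notE[OF lost finds_wall_trans]
  have row_right: "row_free a x y" if "x \<le> b" for x
    using assms(2) that by (auto simp: row_free_def)
  have 1: "\<not> blocked (b, y) East"
  proof
    assume bl: "blocked (b, y) East"
    have "reaches ?c (at_label Gather_left (b - 1, y) {(a, y)} 1)"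
      using bl assms by (intro reaches_block) (simp add: block_def blocked_West row_free_def)
    moreover have "finds_wall (at_label Gather_left (b - 1, y) {(a, y)} 1)"
      using East_imp[OF bl] assms row_right by (intro gather_left) auto
    ultimately show False
      using lostI by blast
  qed
  have r1: "reaches ?c (at_label Grow_right2 (b + 1, y) {(a, y)} 1)"
    using 1 by (intro reaches_block) (simp add: block_def)
  have 2: "\<not> blocked (b + 1, y) North"
  proof
    assume bl: "blocked (b + 1, y) North"
    note r1
    also have "reaches (at_label Grow_right2 (b + 1, y) {(a, y)} 1)
        (at_label Gather_left (b, y) {(a, y)} 1)"
      using bl 1 by (intro reaches_block) (simp add: block_def blocked_West)
    finally have "reaches ?c (at_label Gather_left (b, y) {(a, y)} 1)" .
    moreover have "finds_wall (at_label Gather_left (b, y) {(a, y)} 1)"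
      using North_imp[OF bl] lipschitz[of y] assms by (intro gather_left) auto
    ultimately show False
      using lostI by blast
  qed
  note r1
  also have "reaches (at_label Grow_right2 (b + 1, y) {(a, y)} 1)
      (at_label Grow_right3 (b + 1, y + 1) {(a, y)} 1)"
    using 2 by (intro reaches_block) (simp add: block_def)
  also have "reaches (at_label Grow_right3 (b + 1, y + 1) {(a, y)} 1)
      (at_label Sweep_left (b, y) {(b + 1, y + 1), (a, y)} 0)"
    using 1 2 by (intro reaches_block) (simp add: block_def blocked_West blocked_South)
  also have "reaches (at_label Sweep_left (b, y) {(b + 1, y + 1), (a, y)} 0)
      (at_label Sweep_left (a, y) {(b + 1, y + 1), (a, y)} 0)"
    using assms by (intro West_loop) (auto simp: row_free_def)
  finally have r2: "reaches ?c (at_label Sweep_left (a, y) {(b + 1, y + 1), (a, y)} 0)" .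
  have ab: "\<not> blocked (a, y) East"
    using assms by (auto simp: row_free_def)
  have row1: "row_free a (b + 1) y"
    unfolding row_free_def
  proof (intro allI impI)
    fix x
    assume "a \<le> x \<and> x < b + 1"
    then show "\<not> blocked (x, y) East"
      using assms(2) 1 by (cases "x = b") (auto simp: row_free_def)
  qed
  \<comment> \<open>Fact \<open>2\<close> opens the way up to the right pebble. The bound is
    \<open>lo \<le> y + 1\<close> rather than \<open>lo \<le> y\<close>, since the blocked edge that
    was noticed may belong to the upper row.\<close>
  have gather: "finds_wall (at_label Gather_right_low (x, y) {(b + 1, y + 1)} 1)"
    if "lo \<le> y + 1" "w (y + 1) \<le> b + 1" "x \<le> b + 1" "row_free x (b + 1) y" for x
    using that 2 by (intro gather_right) auto
  have 3: "\<not> blocked (a, y) West"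
  proof
    assume bl: "blocked (a, y) West"
    note r2
    also have "reaches (at_label Sweep_left (a, y) {(b + 1, y + 1), (a, y)} 0)
        (at_label Gather_right_low (a + 1, y) {(b + 1, y + 1)} 1)"
      using bl ab assms(1) by (intro reaches_block) (auto simp: block_def)
    finally have "reaches ?c (at_label Gather_right_low (a + 1, y) {(b + 1, y + 1)} 1)" .
    moreover have "finds_wall (at_label Gather_right_low (a + 1, y) {(b + 1, y + 1)} 1)"
      using East_imp[of "a - 1" y] lipschitz[of y] bl assms row1
      by (intro gather) (auto simp: blocked_West row_free_def)
    ultimately show False
      using lostI by blast
  qed
  note r2
  also have "reaches (at_label Sweep_left (a, y) {(b + 1, y + 1), (a, y)} 0)
      (at_label Grow_left1 (a - 1, y) {(b + 1, y + 1)} 1)"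
    using 3 assms by (intro reaches_block) (auto simp: block_def)
  finally have r3: "reaches ?c (at_label Grow_left1 (a - 1, y) {(b + 1, y + 1)} 1)" .
  have 4: "\<not> blocked (a - 1, y) West"
  proof
    assume bl: "blocked (a - 1, y) West"
    note r3
    also have "reaches (at_label Grow_left1 (a - 1, y) {(b + 1, y + 1)} 1)
        (at_label Gather_right_low (a, y) {(b + 1, y + 1)} 1)"
      using bl 3 by (intro reaches_block) (simp add: block_def blocked_West)
    finally have "reaches ?c (at_label Gather_right_low (a, y) {(b + 1, y + 1)} 1)" .
    moreover have "finds_wall (at_label Gather_right_low (a, y) {(b + 1, y + 1)} 1)"
      using East_imp[of "a - 2" y] lipschitz[of y] bl assms row1
      by (intro gather) (auto simp: blocked_West)
    ultimately show False
      using lostI by blast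
  qed
  note r3
  also have "reaches (at_label Grow_left1 (a - 1, y) {(b + 1, y + 1)} 1)
      (at_label Grow_left2 (a - 2, y) {(b + 1, y + 1)} 1)"
    using 4 by (intro reaches_block) (simp add: block_def)
  finally have r4: "reaches ?c (at_label Grow_left2 (a - 2, y) {(b + 1, y + 1)} 1)" .
  have row2: "row_free (a - 1) (b + 1) y"
    unfolding row_free_def
  proof (intro allI impI)
    fix x
    assume "a - 1 \<le> x \<and> x < b + 1"
    then show "\<not> blocked (x, y) East"
      using row1 3 by (cases "x = a - 1") (auto simp: row_free_def blocked_West)
  qed
  have 5: "\<not> blocked (a - 2, y) North"
  proof
    assume bl: "blocked (a - 2, y) North"
    note r4
    also have "reaches (at_label Grow_left2 (a - 2, y) {(b + 1, y + 1)} 1)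
        (at_label Gather_right_low (a - 1, y) {(b + 1, y + 1)} 1)"
      using bl 4 by (intro reaches_block) (simp add: block_def blocked_West)
    finally have "reaches ?c (at_label Gather_right_low (a - 1, y) {(b + 1, y + 1)} 1)" .
    moreover have "finds_wall (at_label Gather_right_low (a - 1, y) {(b + 1, y + 1)} 1)"
      using North_imp[OF bl] lipschitz[of y] assms row2
      by (intro gather) auto
    ultimately show False
      using lostI by blast
  qed
  note r4
  also have "reaches (at_label Grow_left2 (a - 2, y) {(b + 1, y + 1)} 1)
      (at_label Grow_left3 (a - 2, y + 1) {(b + 1, y + 1)} 1)"
    using 5 by (intro reaches_block) (simp add: block_def)
  finally have r5: "reaches ?c (at_label Grow_left3 (a - 2, y + 1) {(b + 1, y + 1)} 1)" .
  have 6: "\<not> blocked (a - 2, y + 1) East"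
  proof
    assume bl: "blocked (a - 2, y + 1) East"
    note r5
    also have "reaches (at_label Grow_left3 (a - 2, y + 1) {(b + 1, y + 1)} 1)
        (at_label Gather_right_low (a - 1, y) {(b + 1, y + 1)} 1)"
      using bl 4 5 by (intro reaches_block) (simp add: block_def blocked_West blocked_South)
    finally have "reaches ?c (at_label Gather_right_low (a - 1, y) {(b + 1, y + 1)} 1)" .
    moreover have "finds_wall (at_label Gather_right_low (a - 1, y) {(b + 1, y + 1)} 1)"
      using East_imp[OF bl] lipschitz[of y] assms row2
      by (intro gather) auto
    ultimately show False
      using lostI by blast
  qed
  note r5
  also have "reaches (at_label Grow_left3 (a - 2, y + 1) {(b + 1, y + 1)} 1)
      (at_label Sweep_right (a - 1, y + 1) {(a - 2, y + 1), (b + 1, y + 1)} 0)"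
    using 6 assms by (intro reaches_block) (auto simp: block_def)
  finally have r6: "reaches ?c
      (at_label Sweep_right (a - 1, y + 1) {(a - 2, y + 1), (b + 1, y + 1)} 0)" .
  show "reaches ?c
      (at_label Grow_right1 (b + 2, y + 1) {(a - 2, y + 1)} 1) \<and> row_free (a - 2) (b + 2) (y + 1)"
  proof -
    let ?B = "{(a - 2, y + 1), (b + 1, y + 1)}"
    have free: "\<not> blocked (x, y + 1) East" if x: "a - 2 \<le> x" "x < b + 1" for x
    proof
      assume bl: "blocked (x, y + 1) East"
      \<comment> \<open>The blocked edge found at \<open>x\<close> fixes \<open>w (y + 1)\<close>;
        all other horizontal edges of this row are free, which allows the retreat to the left
        pebble.\<close>
      have nb: "\<not> blocked (i, y + 1) East" if "i \<noteq> x" for i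
        using East_imp[of i "y + 1"] East_imp[OF bl] that by auto
      have "x \<noteq> a - 2"
        using bl 6 by auto
      note r6
      also have "reaches (at_label Sweep_right (a - 1, y + 1) ?B 0)
          (at_label Sweep_right (x, y + 1) ?B 0)"
        using x nb \<open>x \<noteq> a - 2\<close> by (intro East_loop) auto
      also have "reaches (at_label Sweep_right (x, y + 1) ?B 0)
          (at_label Back_left (x - 1, y + 1) ?B 0)"
        using x nb[of "x - 1"] \<open>x \<noteq> a - 2\<close> bl
        by (intro reaches_block) (auto simp: block_def blocked_West)
      also have "reaches (at_label Back_left (x - 1, y + 1) ?B 0)
          (at_label Back_left (a - 2, y + 1) ?B 0)"
        using x nb \<open>x \<noteq> a - 2\<close> by (intro West_loop) auto
      also have "reaches (at_label Back_left (a - 2, y + 1) ?B 0)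
          (at_label Gather_right_low (a - 1, y) {(b + 1, y + 1)} 1)"
        using 4 5 assms by (intro reaches_block) (auto simp: block_def blocked_West blocked_South)
      finally have "reaches ?c (at_label Gather_right_low (a - 1, y) {(b + 1, y + 1)} 1)" .
      moreover have "finds_wall (at_label Gather_right_low (a - 1, y) {(b + 1, y + 1)} 1)"
        using East_imp[OF bl] lipschitz[of y] assms row2 x
        by (intro gather) auto
      ultimately show False
        using lostI by blast
    qed
    note r6
    also have "reaches (at_label Sweep_right (a - 1, y + 1) ?B 0)
        (at_label Sweep_right (b + 1, y + 1) ?B 0)"
      using assms free by (intro East_loop) auto
    finally have r7: "reaches ?c (at_label Sweep_right (b + 1, y + 1) ?B 0)" .
    have 7: "\<not> blocked (b + 1, y + 1) East"
    proof
      assume bl: "blocked (b + 1, y + 1) East"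
      note r7
      also have "reaches (at_label Sweep_right (b + 1, y + 1) ?B 0)
          (at_label Gather_left (b, y + 1) {(a - 2, y + 1)} 1)"
        using bl free[of b] assms by (intro reaches_block) (auto simp: block_def blocked_West)
      finally have "reaches ?c (at_label Gather_left (b, y + 1) {(a - 2, y + 1)} 1)" .
      moreover have "finds_wall (at_label Gather_left (b, y + 1) {(a - 2, y + 1)} 1)"
        using East_imp[OF bl] assms free by (intro gather_left) (auto simp: row_free_def)
      ultimately show False
        using lostI by blast
    qed
    note r7
    also have "reaches (at_label Sweep_right (b + 1, y + 1) ?B 0)
        (at_label Grow_right1 (b + 2, y + 1) {(a - 2, y + 1)} 1)"
      using 7 assms by (intro reaches_block) (auto simp: block_def)
    finally have "reaches ?c (at_label Grow_right1 (b + 2, y + 1) {(a - 2, y + 1)} 1)" .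
    moreover have "\<not> blocked (x, y + 1) East" if "a - 2 \<le> x" "x < b + 2" for x
      using free[of x] 7 that by (cases "x = b + 1") auto
    ultimately show ?thesis
      by (simp add: row_free_def)
  qed
qed

lemma finds_wall_start: "finds_wall (at_label Start (p, q) {} 2)"
proof (cases "blocked (p, q) East")
  case True
  have "w q = p + 1" "lo \<le> q"
    using East_imp[OF True] by auto
  then show ?thesis
    using True free_path_climb[of False q "- p"] climb_Suc_neq_Nil
    by (intro finds_wall_climb[of q False "- p"] reaches_block)
      (simp_all add: block_def wall_at_def mirror_def)
next
  case False
  let ?c = "\<lambda>k. at_label Grow_right1 (p + 1 + 2 * int k, q + int k) {(p - 2 * int k, q + int k)} 1"
  have start: "reaches (at_label Start (p, q) {} 2) (?c 0)"
    using False by (intro reaches_block) (simp add: block_def)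
  have "finds_wall (?c 0)"
  proof (rule ccontr)
    assume lost: "\<not> finds_wall (?c 0)"
    have rounds: "reaches (?c 0) (?c k) \<and>
        row_free (p - 2 * int k) (p + 1 + 2 * int k) (q + int k)" for k
    proof (induction k)
      case 0
      show ?case
        using False by (auto simp: row_free_def dest: order.antisym)
    next
      case (Suc k)
      have "\<not> finds_wall (?c k)"
        using lost Suc finds_wall_trans by blast
      then show ?case
        using sweep_round[of "p - 2 * int k" "p + 1 + 2 * int k" "q + int k"] Suc
          reach_trans[of blocked _ "?c 0" "?c k" "?c (Suc k)"]
        by (simp add: algebra_simps)
    qed
    \<comment> \<open>In \<open>k\<close> rounds each end of the row moves by \<open>2 * k\<close>,
      the wall by at most \<open>k\<close>. So an excess of \<open>k\<close> over the initial
      distance from \<open>p\<close> to \<open>w q\<close> encloses the wall, and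
      \<open>hi - q\<close> rounds lead to rows without holes.\<close>
    define k where "k = nat (hi - q) + nat \<bar>w q - p\<bar> + 1"
    have "hi - q \<le> int k" "\<bar>w q - p\<bar> < int k"
      by (auto simp: k_def)
    moreover have "\<bar>w (q + int k) - w q\<bar> \<le> int k"
      using lipschitz_diff[of "q + int k" q] by simp
    ultimately
    have "hi \<le> q + int k" "p - 2 * int k \<le>
        w (q + int k) - 1" "w (q + int k) - 1 < p + 1 + 2 * int k"
      by linarith+
    then show False
      using rounds[of k] blocked_East[of "q + int k"] unfolding row_free_def by blast
  qed
  then show ?thesis
    using start finds_wall_trans by blast
qed

end

section \<open>Walking along the wall and excursions to it\<close>

context wall
begin

text \<open>The lowest row from which on the wall is met in every row.\<close>

definition bottom :: int where
  "bottom = hi - int (LEAST n. \<not> blocked (w (hi - int n - 1) - 1, hi - int n - 1) East)"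

lemma bottom:
  "bottom \<le> hi" "lo \<le> bottom" "\<not> blocked (w (bottom - 1) - 1, bottom - 1) East"
  "bottom \<le> y \<Longrightarrow> blocked (w y - 1, y) East"
proof -
  let ?P = "\<lambda>n. \<not> blocked (w (hi - int n - 1) - 1, hi - int n - 1) East"
  have "?P (nat (hi - lo))"
    using East_imp[of "w (lo - 1) - 1" "lo - 1"] lo_le_hi by auto
  then have P: "?P (LEAST n. ?P n)" and le: "(LEAST n. ?P n) \<le> nat (hi - lo)"
    by (rule LeastI, rule Least_le)
  show "bottom \<le> hi" "lo \<le> bottom" "\<not> blocked (w (bottom - 1) - 1, bottom - 1) East"
    using P le lo_le_hi by (auto simp: bottom_def)
  show "blocked (w y - 1, y) East" if "bottom \<le> y"
  proof (cases "hi \<le> y")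
    case True
    then show ?thesis
      by (rule blocked_East)
  next
    case False
    then have "nat (hi - y - 1) < (LEAST n. ?P n)"
      using that by (auto simp: bottom_def)
    from not_less_Least[OF this] show ?thesis
      using False by simp
  qed
qed

lemma inward_iff: "blocked (mirror s x y) (inward s) \<longleftrightarrow>
    x = wall_at s y \<and> blocked (mirror s (wall_at s y) y) (inward s)"
  using inward_imp by blast

lemma blocked_wall_at: "blocked (mirror s (wall_at s y) y) (inward s) \<longleftrightarrow> blocked (w y - 1, y) East"
  by (auto simp: mirror_def inward_def wall_at_def blocked_West)

text \<open>Past the lower end, \<open>Down1\<close> is entered at column
  \<open>wall_at s bottom + 1\<close>, and two free inward moves lead to this node. The third free
  port, tested here, shows that the wall has ended.\<close>

definition goal :: "bool \<Rightarrow> node" where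
  "goal s = mirror s (wall_at s bottom - 1) (bottom - 1)"

lemma not_blocked_low: "y < lo \<Longrightarrow> \<not> blocked (x, y) d"
  using East_imp[of x y] East_imp[of "x - 1" y] North_imp[of x y] North_imp[of x "y - 1"]
  by (cases d) (auto simp: blocked_West blocked_South)

text \<open>An excursion repeats the moves north, inward, inward. The milestones are the nodes between
  these repetitions.\<close>

definition milestone :: "bool \<Rightarrow> int \<Rightarrow> int \<Rightarrow> nat \<Rightarrow> node" where
  "milestone s r y j = mirror s (r - 2 * int j) (y + int j)"

definition reachable_milestone :: "bool \<Rightarrow> int \<Rightarrow> int \<Rightarrow> nat \<Rightarrow> bool" where
  "reachable_milestone s r y j \<longleftrightarrow> wall_at s (y + int j) \<le> r - 2 * int j"

text \<open>From one milestone to the next, the path loses two columns while the wall recedes by at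
  most one, so the distance to the wall strictly decreases.\<close>

lemma reachable_milestone_mono:
  "reachable_milestone s r y j \<Longrightarrow> i \<le> j \<Longrightarrow> reachable_milestone s r y i"
  using wall_at_diff[of s "y + int i" "y + int j"] by (auto simp: reachable_milestone_def)

end

section \<open>Descent along the wall\<close>

context wall_agent
begin

text \<open>The wall is first touched under \<open>To_wall\<close> and later under any of the three
  \<open>Down\<close> labels. The induction covers all of them by assuming only their common
  reaction to a blocked inward port.\<close>

lemma descend:
  assumes "bottom \<le> y"
    and descending: "\<And>F. inward s \<notin> F \<Longrightarrow> prog l F False 2 = (Keep, [outward s, South], Down1 s)"
  shows "reaches (at_label l (mirror s (wall_at s y) y) {} 2) (at_label (Down3 s) (goal s) {} 2)"
  using assms
proof (induction "nat (y - bottom)" arbitrary: y l rule: less_induct)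
  case less
  let ?x = "wall_at s y"
  have "blocked (mirror s ?x y) (inward s)"
    using bottom(4)[OF less.prems(1)] by (simp add: blocked_wall_at)
  moreover have "\<not> blocked (mirror s ?x y) (outward s)" "\<not> blocked (mirror s (?x + 1) y) South"
    using not_blocked_inward[of s y "?x + 1"] not_blocked_North[of s "y - 1"
      "?x + 1"] wall_at_step[of s y]
    by (simp_all add: blocked_outward mirror_South)
  ultimately have 1: "reaches (at_label l (mirror s ?x y) {} 2)
      (at_label (Down1 s) (mirror s (?x + 1) (y - 1)) {} 2)"
    using less.prems(2) by (intro reaches_block) (simp add: block_def)
  show ?case
  proof (cases "y = bottom")
    case True
    \<comment> \<open>The only edge of this row that could be blocked is free by the choice of
      \<open>bottom\<close>.\<close>
    then have free: "\<not> blocked (mirror s x (y - 1)) (inward s)" for x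
      using bottom(3) inward_iff[of s x "y - 1"] by (simp add: blocked_wall_at)
    note 1
    also have "reaches (at_label (Down1 s) (mirror s (?x + 1) (y - 1)) {} 2)
        (at_label (Down2 s) (mirror s ?x (y - 1)) {} 2)"
      using free by (intro reaches_block) (simp add: block_def)
    also have "reaches (at_label (Down2 s) (mirror s ?x (y - 1)) {} 2)
        (at_label (Down3 s) (mirror s (?x - 1) (y - 1)) {} 2)"
      using free by (intro reaches_block) (simp add: block_def)
    finally show ?thesis
      by (simp add: True goal_def)
  next
    case False
    then have y: "bottom \<le> y - 1"
      using less.prems by simp
    have IH: "reaches (at_label l (mirror s (wall_at s (y - 1)) (y - 1)) {} 2)
        (at_label (Down3 s) (goal s) {} 2)"
      if "l \<in> {Down1 s, Down2 s, Down3 s}" for l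
      using y that by (intro less.hyps) auto
    have free: "blocked (mirror s x (y - 1)) (inward s) \<longleftrightarrow> x = wall_at s (y - 1)" for x
      using bottom(4)[OF y] inward_iff[of s x "y - 1"] by (simp add: blocked_wall_at)
    \<comment> \<open>These are precisely the columns at which \<open>Down1\<close>,
      \<open>Down2\<close> and \<open>Down3\<close> test the inward port.\<close>
    consider "wall_at s (y - 1) = ?x + 1" | "wall_at s (y - 1) = ?x" | "wall_at s (y - 1) = ?x - 1"
      using wall_at_step[of s y] by linarith
    then show ?thesis
    proof cases
      case a: 1
      note 1
      also have "reaches (at_label (Down1 s) (mirror s (?x + 1) (y - 1)) {} 2)
          (at_label (Down3 s) (goal s) {} 2)"
        using IH[of "Down1 s"] a by simp
      finally show ?thesis .
    next
      case a: 2
      note 1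
      also have "reaches (at_label (Down1 s) (mirror s (?x + 1) (y - 1)) {} 2)
          (at_label (Down2 s) (mirror s ?x (y - 1)) {} 2)"
        using free a by (intro reaches_block) (simp add: block_def)
      also have "reaches (at_label (Down2 s) (mirror s ?x (y - 1)) {} 2)
          (at_label (Down3 s) (goal s) {} 2)"
        using IH[of "Down2 s"] a by simp
      finally show ?thesis .
    next
      case a: 3
      note 1
      also have "reaches (at_label (Down1 s) (mirror s (?x + 1) (y - 1)) {} 2)
          (at_label (Down2 s) (mirror s ?x (y - 1)) {} 2)"
        using free a by (intro reaches_block) (simp add: block_def)
      also have "reaches (at_label (Down2 s) (mirror s ?x (y - 1)) {} 2)
          (at_label (Down3 s) (mirror s (?x - 1) (y - 1)) {} 2)"
        using free a by (intro reaches_block) (simp add: block_def)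
      also have "reaches (at_label (Down3 s) (mirror s (?x - 1) (y - 1)) {} 2)
          (at_label (Down3 s) (goal s) {} 2)"
        using IH[of "Down3 s"] a by simp
      finally show ?thesis .
    qed
  qed
qed

lemma reaches_goal: "\<exists>s. reaches (at_label Start u {} 2) (at_label (Down3 s) (goal s) {} 2)"
proof -
  obtain p q where u: "u = (p, q)"
    by (cases u)
  obtain s x y where y: "hi \<le> y" "wall_at s y \<le> x"
      and 1: "reaches (at_label Start u {} 2) (at_label (To_wall s) (mirror s x y) {} 2)"
    using finds_wall_start[of p q] u unfolding finds_wall_def by blast
  have "reaches (at_label (To_wall s) (mirror s x y) {} 2)
      (at_label (To_wall s) (mirror s (wall_at s y) y) {} 2)"
    using y not_blocked_inward by (intro inward_loop) auto
  moreover have "reaches (at_label (To_wall s) (mirror s (wall_at s y) y) {} 2)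
      (at_label (Down3 s) (goal s) {} 2)"
    using y bottom(1) by (intro descend) auto
  ultimately show ?thesis
    using 1 reach_trans by blast
qed

section \<open>Excursions from a pebble to the wall and back\<close>

context
  fixes s :: bool and r y :: int and B :: "node set" and k :: nat
  assumes low: "y + 1 < lo" and far: "wall_at s hi + 2 * hi \<le> r + 2 * y"
    and pebbles: "\<And>u. u \<in> B \<Longrightarrow> snd u = y" and home: "mirror s r y \<in> B"
begin

lemma milestone_notin: "0 < j \<Longrightarrow> milestone s r y j \<notin> B"
  using pebbles[of "milestone s r y j"] by (auto simp: milestone_def mirror_def)

text \<open>The first North move belongs to the block that leaves the pebble. Hence the path begins
  under \<open>Out1\<close>, and milestone 0, the pebble itself, is never entered under
  \<open>Out0\<close>.\<close>

lemma excursion_out: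
  "reachable_milestone s r y (Suc j) \<Longrightarrow>
    reaches (at_label (Out1 s) (mirror s r (y + 1)) B k)
        (at_label (Out0 s) (milestone s r y (Suc j)) B k)"
proof (induction j)
  case 0
  have w1: "wall_at s (y + 1) \<le> r - 2"
    using 0 by (simp add: reachable_milestone_def)
  have "reaches (at_label (Out1 s) (mirror s r (y + 1)) B k)
      (at_label (Out2 s) (mirror s (r - 1) (y + 1)) B k)"
    using w1 not_blocked_inward[of s "y + 1" r] by (intro reaches_block) (simp add: block_def)
  also have "reaches (at_label (Out2 s) (mirror s (r - 1) (y + 1)) B k)
      (at_label (Out0 s) (mirror s (r - 2) (y + 1)) B k)"
    using w1 not_blocked_inward[of s "y + 1" "r - 1"] by (intro reaches_block) (simp add: block_def)
  finally show ?case
    by (simp add: milestone_def)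
next
  case (Suc j)
  obtain u v where uv: "milestone s r y (Suc j) = mirror s u v" "milestone s r y (Suc (Suc j))
      = mirror s (u - 2) (v + 1)"
      and w: "wall_at s v \<le> u" "wall_at s (v + 1) \<le> u - 2"
  proof (rule that)
    let ?u = "r - 2 * int (Suc j)" and ?v = "y + int (Suc j)"
    show "milestone s r y (Suc j) = mirror s ?u ?v" "milestone s r y (Suc (Suc j))
        = mirror s (?u - 2) (?v + 1)"
      by (simp_all add: milestone_def)
    show "wall_at s ?v \<le> ?u" "wall_at s (?v + 1) \<le> ?u - 2"
      using Suc.prems reachable_milestone_mono[OF Suc.prems, of "Suc j"]
      by (auto simp: reachable_milestone_def algebra_simps)
  qed
  have "reaches (at_label (Out1 s) (mirror s r (y + 1)) B k) (at_label (Out0 s) (mirror s u v) B k)"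
    using Suc.IH reachable_milestone_mono[OF Suc.prems, of "Suc j"] by (simp add: uv)
  also have "reaches (at_label (Out0 s) (mirror s u v) B k)
      (at_label (Out1 s) (mirror s u (v + 1)) B k)"
    using w not_blocked_North[of s v u] by (intro reaches_block) (simp add: block_def)
  also have "reaches (at_label (Out1 s) (mirror s u (v + 1)) B k)
      (at_label (Out2 s) (mirror s (u - 1) (v + 1)) B k)"
    using w not_blocked_inward[of s "v + 1" u] by (intro reaches_block) (simp add: block_def)
  also have "reaches (at_label (Out2 s) (mirror s (u - 1) (v + 1)) B k)
      (at_label (Out0 s) (mirror s (u - 2) (v + 1)) B k)"
    using w not_blocked_inward[of s "v + 1" "u - 1"] by (intro reaches_block) (simp add: block_def)
  finally show ?case
    by (simp add: uv)
qed

lemma free_return_step: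
  assumes "wall_at s v \<le> u"
  shows "\<not> blocked (mirror s u v) (outward s)" "\<not> blocked (mirror s (u + 1) v) (outward s)"
    "\<not> blocked (mirror s (2 + u) v) South"
  using assms wall_at_step(3)[of s v] not_blocked_inward[of s v "u + 1"] not_blocked_inward[of s v
    "2 + u"]
    not_blocked_North[of s "v - 1" "2 + u"]
  by (simp_all add: blocked_outward mirror_South)

lemma milestone_Suc: "milestone s r y j = mirror s (2 + u) (v - 1) \<longleftrightarrow>
    milestone s r y (Suc j) = mirror s u v"
  by (auto simp: milestone_def)

text \<open>All milestones except milestone 0 lie above the row of the pebbles, so
  \<open>Return\<close> cannot stop too early.\<close>

lemma excursion_back:
  "reachable_milestone s r y j \<Longrightarrow>
    reaches (at_label (Return s) (milestone s r y j) B k) (at_label (Return s) (mirror s r y) B k)"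
proof (induction j)
  case (Suc j)
  obtain u v where uv: "milestone s r y (Suc j) = mirror s u v" and w: "wall_at s v \<le> u"
    using Suc.prems by (simp add: milestone_def reachable_milestone_def)
  have "reaches (at_label (Return s) (mirror s u v) B k)
      (at_label (Return s) (mirror s (2 + u) (v - 1)) B k)"
    using free_return_step[OF w] milestone_notin[of "Suc j"] uv
    by (intro reaches_block) (simp add: block_def)
  moreover have "milestone s r y j = mirror s (2 + u) (v - 1)"
    using milestone_Suc uv by blast
  moreover have "reachable_milestone s r y j"
    using Suc.prems by (rule reachable_milestone_mono) simp
  ultimately show ?case
    using reach_trans[OF _ Suc.IH] uv by simp
qed (simp add: milestone_def)

lemma last_milestone:
  obtains j where "0 < j" "hi \<le>
      y + int j" "reachable_milestone s r y j" "\<not> reachable_milestone s r y (Suc j)"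
proof -
  define j0 where "j0 = nat (hi - y)"
  have j0: "0 < j0" "y + int j0 = hi"
    using low lo_le_hi by (auto simp: j0_def)
  \<comment> \<open>The condition \<open>far\<close> says that the milestone in row
    \<open>hi\<close> is still on its side of the wall.\<close>
  then have "reachable_milestone s r y j0"
    using far by (auto simp: reachable_milestone_def)
  have "\<not> reachable_milestone s r y j" if "nat \<bar>r - wall_at s y\<bar> < j" for j
    using wall_at_diff[of s "y + int j" y] that by (auto simp: reachable_milestone_def)
  then have bound: "j \<le> nat \<bar>r - wall_at s y\<bar>" if "reachable_milestone s r y j" for j
    using that not_less by blast
  define j where "j = (GREATEST j. reachable_milestone s r y j)"
  have "reachable_milestone s r y j"
    unfolding j_def using \<open>reachable_milestone s r y j0\<close> bound by (rule GreatestI_nat)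
  moreover have max: "i \<le> j" if "reachable_milestone s r y i" for i
    unfolding j_def using that bound by (rule Greatest_le_nat)
  then have "\<not> reachable_milestone s r y (Suc j)"
    using Suc_n_not_le_n by blast
  moreover have "j0 \<le> j"
    using \<open>reachable_milestone s r y j0\<close> by (rule max)
  then have "0 < j" "hi \<le> y + int j"
    using j0 by linarith+
  ultimately show thesis
    by (intro that[of j])
qed

text \<open>Above the last milestone there are no holes, so one of the next three moves is stopped:
  North, the first or the second inward move, depending on the position of the wall in the next row.
  Each case leads back to a milestone from which \<open>excursion_back\<close> applies.\<close>

lemma excursion:
  "reaches (at_label (Out1 s) (mirror s r (y + 1)) B k) (at_label (Return s) (mirror s r y) B k)"
proof -
  obtain j where j: "0 < j" "hi \<le>
      y + int j" "reachable_milestone s r y j" "\<not> reachable_milestone s r y (Suc j)"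
    by (rule last_milestone)
  then obtain i where i: "j = Suc i"
    by (cases j) auto
  define u v where "u = r - 2 * int j" and "v = y + int j"
  have uv: "milestone s r y j = mirror s u v"
    by (simp add: u_def v_def milestone_def)
  have w: "wall_at s v \<le> u" "u - 2 < wall_at s (v + 1)" and hi: "hi \<le> v"
    using j by (auto simp: reachable_milestone_def u_def v_def algebra_simps)
  have out: "reaches (at_label (Out1 s) (mirror s r (y + 1)) B k)
      (at_label (Out0 s) (mirror s u v) B k)"
    using excursion_out[of i] j(3) i uv by simp
  have home_again: "reaches (at_label (Return s) (mirror s u v) B k)
      (at_label (Return s) (mirror s r y) B k)"
    using excursion_back[OF j(3)] uv by simp
  show ?thesis
  proof (cases "wall_at s (v + 1) \<le> u")
    case False
    then have bl: "blocked (mirror s u v) North"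
      using w hi by (intro blocked_mirror_North) auto
    \<comment> \<open>A block has to move, so a blocked North port sends the agent back to the
      preceding milestone at once.\<close>
    have r: "reachable_milestone s r y i"
      using j(3) by (rule reachable_milestone_mono) (simp add: i)
    have m: "milestone s r y i = mirror s (2 + u) (v - 1)"
      using milestone_Suc uv i by blast
    note out
    also have "reaches (at_label (Out0 s) (mirror s u v) B k)
        (at_label (Return s) (mirror s (2 + u) (v - 1)) B k)"
      using bl free_return_step[OF w(1)] by (intro reaches_block) (simp add: block_def)
    also have "reaches (at_label (Return s) (mirror s (2 + u) (v - 1)) B k)
        (at_label (Return s) (mirror s r y) B k)"
      using excursion_back[OF r] m by simp
    finally show ?thesis .
  next
    case True
    have North: "\<not> blocked (mirror s u v) North"
      using w True not_blocked_North[of s v u] by simp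
    note out
    also have "reaches (at_label (Out0 s) (mirror s u v) B k)
        (at_label (Out1 s) (mirror s u (v + 1)) B k)"
      using North by (intro reaches_block) (simp add: block_def)
    finally have out1: "reaches (at_label (Out1 s) (mirror s r (y + 1)) B k)
        (at_label (Out1 s) (mirror s u (v + 1)) B k)" .
    have bl: "blocked (mirror s x (v + 1)) (inward s) \<longleftrightarrow> x = wall_at s (v + 1)" for x
      using blocked_inward[of "v + 1" s] inward_iff[of s x "v + 1"] hi by auto
    show ?thesis
    proof (cases "wall_at s (v + 1) = u")
      case a: True
      note out1
      also have "reaches (at_label (Out1 s) (mirror s u (v + 1)) B k)
          (at_label (Return s) (mirror s u v) B k)"
        using bl[of u] a North by (intro reaches_block) (simp add: block_def mirror_South)
      also note home_again
      finally show ?thesis .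
    next
      case a: False
      then have a: "wall_at s (v + 1) = u - 1"
        using True w by simp
      note out1
      also have "reaches (at_label (Out1 s) (mirror s u (v + 1)) B k)
          (at_label (Out2 s) (mirror s (u - 1) (v + 1)) B k)"
        using bl[of u] a by (intro reaches_block) (simp add: block_def)
      also have "reaches (at_label (Out2 s) (mirror s (u - 1) (v + 1)) B k)
          (at_label (Return s) (mirror s u v) B k)"
        using bl[of u] bl[of "u - 1"] a North
        by (intro reaches_block) (simp add: block_def mirror_South blocked_outward)
      also note home_again
      finally show ?thesis .
    qed
  qed
qed

end

end

section \<open>Loops around the end of the wall\<close>

context wall
begin

text \<open>Two rows below \<open>lo\<close>, so that the row above the pebbles contains no blocked
  edge either.\<close>

definition base :: int where
  "base = lo - 2"

text \<open>A common bound for both sides: already the first excursions pass row \<open>hi\<close>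
  on their own side, and the ideal wall in row \<open>base\<close> does not extend beyond the
  pebbles.\<close>

definition width :: int where
  "width = 1 + (\<Sum>s\<in>UNIV. \<bar>wall_at s hi + 2 * hi - 2 * base\<bar> + \<bar>wall_at s base\<bar>)"

lemma width: "0 < width" "wall_at s hi + 2 * hi \<le> width + 2 * base" "wall_at s base \<le> width"
  by (cases s; simp add: width_def UNIV_bool)+

text \<open>The nodes that the loops may miss.\<close>

definition core :: "node set" where
  "core = (\<Union>s. (\<lambda>(x, y). mirror s x y) `
    ({2 * wall_at s base - width..width} \<times> {base..width + base - wall_at s base}))"

lemma finite_core: "finite core"
  by (simp add: core_def)

text \<open>Between row \<open>base\<close>, the wall and the first excursion line lies a triangle:
  going up, the line approaches by two columns per row, whereas the wall recedes by at most one. The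
  box in \<open>core\<close> encloses it.\<close>

lemma core_cases:
  assumes "base < y" "wall_at s y \<le> x"
  shows "mirror s x y \<in> core \<or> width + 2 * base \<le> x + 2 * y"
proof (rule disjCI)
  assume "\<not> width + 2 * base \<le> x + 2 * y"
  moreover have "wall_at s base - (y - base) \<le> wall_at s y"
    using wall_at_diff[of s base y] assms(1) by linarith
  ultimately show "mirror s x y \<in> core"
    using assms unfolding core_def by (intro UN_I[of s] image_eqI[of _ _ "(x, y)"]) auto
qed

end

context wall_agent
begin

definition visits :: "nat config \<Rightarrow> node \<Rightarrow> bool" where
  "visits c u \<longleftrightarrow> (\<exists>n. position ((step blocked (compile N prog Start) ^^ n) c) = u)"

lemma visits_trans: "reaches c c' \<Longrightarrow> visits c' u \<Longrightarrow> visits c u"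
  unfolding visits_def reach_def by (metis funpow_add comp_apply)

lemma visitsI: "reaches c (config_at l ds u B k) \<Longrightarrow> visits c u"
  unfolding visits_def reach_def by (metis position_config_at)

abbreviation loop_start :: "int \<Rightarrow> int \<Rightarrow> nat config" where
  "loop_start r y \<equiv> at_label Put_right (r, y) {(- r, y)} 1"

section \<open>A single loop\<close>

context
  fixes r y :: int
  assumes low: "y + 1 < lo" and r: "0 < r" and far: "\<And>s. wall_at s hi + 2 * hi \<le> r + 2 * y"
begin

lemma free_low: "\<not> blocked (x, y) d" "\<not> blocked (x, y - 1) d" "\<not> blocked (x, y + 1) d"
  using low by (simp_all add: not_blocked_low)

lemma loop_Out_right: "reaches (loop_start r y)
    (at_label (Out1 True) (mirror True r (y + 1)) {(r, y), (- r, y)} 0)"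
  using r free_low by (intro reaches_block) (simp add: block_def mirror_def)

lemma loop_excursion:
  "reaches (at_label (Out1 s) (mirror s r (y + 1)) {(r, y), (- r, y)} k)
    (at_label (Return s) (mirror s r y) {(r, y), (- r, y)} k)"
  using low far[of s] by (intro excursion) (auto simp: mirror_def)

lemma loop_Row_left:
  assumes "- r \<le> x" "x < r"
  shows "reaches (loop_start r y) (at_label Row_left (x, y) {(r, y), (- r, y)} 0)"
proof -
  note loop_Out_right
  also have "reaches (at_label (Out1 True) (mirror True r (y + 1)) {(r, y), (- r, y)} 0)
      (at_label (Return True) (r, y) {(r, y), (- r, y)} 0)"
    using loop_excursion[of True 0] by (simp add: mirror_def)
  also have "reaches (at_label (Return True) (r, y) {(r, y), (- r, y)} 0)
      (at_label Row_left (r - 1, y) {(r, y), (- r, y)} 0)"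
    using free_low by (intro reaches_block) (simp add: block_def)
  also have "reaches (at_label Row_left (r - 1, y) {(r, y), (- r, y)} 0)
      (at_label Row_left (x, y) {(r, y), (- r, y)} 0)"
    using free_low assms by (intro West_loop) auto
  finally show ?thesis .
qed

lemma loop_Out:
  "reaches (loop_start r y) (at_label (Out1 s) (mirror s r (y + 1)) {(r, y), (- r, y)} 0)"
proof (cases s)
  case True
  then show ?thesis
    using loop_Out_right by simp
next
  case False
  have "reaches (loop_start r y) (at_label Row_left (- r, y) {(r, y), (- r, y)} 0)"
    using r by (intro loop_Row_left) auto
  also have "reaches (at_label Row_left (- r, y) {(r, y), (- r, y)} 0)
      (at_label (Out1 s) (mirror s r (y + 1)) {(r, y), (- r, y)} 0)"
    using False free_low by (intro reaches_block) (simp add: block_def mirror_def)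
  finally show ?thesis .
qed

lemma visits_row:
  assumes "- r \<le> x" "x \<le> r"
  shows "visits (loop_start r y) (x, y)"
proof (cases "x = r")
  case True
  then show ?thesis
    using visitsI[OF reach_refl] by blast
next
  case False
  then show ?thesis
    using loop_Row_left[of x] assms by (intro visitsI) auto
qed

lemma visits_milestone:
  assumes "reachable_milestone s r y (Suc j)"
  shows "visits (loop_start r y) (milestone s r y (Suc j))"
proof -
  note loop_Out
  also have "reaches (at_label (Out1 s) (mirror s r (y + 1)) {(r, y), (- r, y)} 0)
      (at_label (Out0 s) (milestone s r y (Suc j)) {(r, y), (- r, y)} 0)"
    using assms low far[of s] by (intro excursion_out) (auto simp: mirror_def)
  finally show ?thesis
    by (rule visitsI)
qed

text \<open>The left pebble is moved first. From its new place the agent returns to the old row,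
  which still leads to the right pebble; moving that one as well restores the initial situation one
  row lower.\<close>

lemma loop_round: "reaches (loop_start r y) (loop_start (r + 3) (y - 1))"
proof -
  let ?B = "{(r, y), (- r, y)}" and ?P = "{(- r - 3, y - 1), (r, y)}"
  note loop_Out[of False]
  also have "reaches (at_label (Out1 False) (mirror False r (y + 1)) ?B 0)
      (at_label (Return False) (- r, y) ?B 0)"
    using loop_excursion[of False 0] by (simp add: mirror_def)
  also have "reaches (at_label (Return False) (- r, y) ?B 0)
      (at_label Put_left (- r - 3, y - 1) {(r, y)} 1)"
    using free_low r by (intro reaches_block) (auto simp: block_def)
  also have "reaches (at_label Put_left (- r - 3, y - 1) {(r, y)} 1)
      (at_label Row_right (- r + 1, y) ?P 0)"
    using free_low by (intro reaches_block) (auto simp: block_def)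
  also have "reaches (at_label Row_right (- r + 1, y) ?P 0) (at_label Row_right (r, y) ?P 0)"
    using free_low r by (intro East_loop) auto
  also have "reaches (at_label Row_right (r, y) ?P 0) (loop_start (r + 3) (y - 1))"
    using free_low by (intro reaches_block) (auto simp: block_def)
  finally show ?thesis .
qed

end

section \<open>The family of all loops\<close>

definition loop :: "nat \<Rightarrow> nat config" where
  "loop k = loop_start (width + 3 * int k) (base - int k)"

lemma loop_far: "base - int k + 1 < lo" "0 < width + 3 * int k"
    "wall_at s hi + 2 * hi \<le> width + 3 * int k + 2 * (base - int k)"
  using width(1) width(2)[of s] by (auto simp: base_def)

lemma reaches_loop: "reaches (loop 0) (loop k)"
proof (rule reach_iterate)
  fix i
  show "reaches (loop i) (loop (Suc i))"
    using loop_round[OF loop_far(1,2)[of i] loop_far(3)[of _ i]]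
    by (simp add: loop_def algebra_simps)
qed

text \<open>The value of \<open>x + 2 * y\<close> is the same at all milestones of an excursion, so
  it determines the loop \<open>k\<close> that meets the node. The last condition places the node
  above the pebbles of this loop.\<close>

lemma loops_side:
  assumes x: "wall_at s y \<le> x" and k: "x + 2 * y = width + 2 * base + int k"
      and y: "base - int k < y"
  shows "visits (loop 0) (mirror s x y)"
proof -
  define j where "j = nat (y - (base - int k) - 1)"
  have "int (Suc j) = y - (base - int k)"
    using y by (simp add: j_def)
  then have j: "y = base - int k + int (Suc j)" "x = width + 3 * int k - 2 * int (Suc j)"
    using k by auto
  have "visits (loop k) (mirror s x y)"
    using visits_milestone[OF loop_far(1,2)[of k] loop_far(3)[of _ k], of s j] x
    unfolding loop_def milestone_def reachable_milestone_def j[symmetric] by blast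
  then show ?thesis
    using reaches_loop visits_trans by blast
qed

lemma loops_cover: "u \<in> core \<or> visits (loop 0) u"
proof (cases "base < snd u")
  case True
  obtain s x y where u: "u = mirror s x y" and x: "wall_at s y \<le> x"
    by (rule mirror_cases)
  with True have y: "base < y"
    by (simp add: mirror_def)
  show ?thesis
    using core_cases[OF y x]
  proof
    assume "width + 2 * base \<le> x + 2 * y"
    then show ?thesis
      using loops_side[OF x, of "nat (x + 2 * y - (width + 2 * base))"] y u by simp
  qed (simp add: u)
next
  case False
  obtain x y where u: "u = (x, y)"
    by (cases u)
  define k where "k = nat (base - y)"
  have y: "y = base - int k"
    using False u by (simp add: k_def)
  \<comment> \<open>Beyond the pebbles of loop \<open>k\<close>, the value of
    \<open>x' + 2 * y\<close> belongs to a later loop, whose row lies below \<open>y\<close>. So its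
    excursion passes through the node.\<close>
  have outer: "visits (loop 0) (mirror s x' y)" if "width + 3 * int k < x'" for s x'
  proof (rule loops_side)
    show "wall_at s y \<le> x'"
      using that wall_at_diff[of s y base] width(3)[of s] by (simp add: y)
    show "x' + 2 * y = width + 2 * base + int (nat (x' + 2 * y - (width + 2 * base)))"
        "base - int (nat (x' + 2 * y - (width + 2 * base))) < y"
      using that y by auto
  qed
  consider "width + 3 * int k < x" | "width + 3 * int k < - x" | "- (width + 3 * int k) \<le> x" "x \<le>
      width + 3 * int k"
    by linarith
  then show ?thesis
  proof cases
    case 1
    then show ?thesis
      using outer[of x True] by (simp add: u mirror_def)
  next
    case 2
    then show ?thesis
      using outer[of "- x" False] by (simp add: u mirror_def)
  next
    case 3
    then have "visits (loop k) u"
      using visits_row[OF loop_far(1,2)[of k] loop_far(3)[of _ k]] by (simp add: u y loop_def)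
    then show ?thesis
      using reaches_loop visits_trans by blast
  qed
qed

lemma explores_all:
  assumes tour: "\<And>s. tour s \<noteq> [] \<and> free_path blocked (goal s) (tour s) \<and>
      walk (goal s) (tour s) = (- width, base) \<and>
      (\<forall>u\<in>core. \<exists>ds1 ds2. tour s = ds1 @ ds2 \<and> ds1 \<noteq> [] \<and> walk (goal s) ds1 = u)"
    and deploy: "deploy \<noteq> []" "free_path blocked (- width, base) deploy"
        "walk (- width, base) deploy = (width, base)"
  shows "explores blocked UNIV 2 (compile N prog Start)"
proof -
  have "visits (at_label Start v {} 2) u" for u v
  proof -
    obtain s where goal: "reaches (at_label Start v {} 2) (at_label (Down3 s) (goal s) {} 2)"
      using reaches_goal by blast
    have "\<not> blocked (goal s) (inward s)"
      using bottom(3) inward_iff[of s "wall_at s bottom - 1" "bottom - 1"]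
      by (simp add: goal_def blocked_wall_at)
    then have prog: "prog (Down3 s) {d. \<not> blocked (goal s) d} (goal s \<in> {}) 2
        = (Keep, tour s, Deploy)"
      by simp
    have "visits (at_label (Down3 s) (goal s) {} 2) u"
    proof (cases "u \<in> core")
      case True
      then obtain ds1 ds2 where ds: "tour s = ds1 @ ds2" "ds1 \<noteq> []" "walk (goal s) ds1 = u"
        using tour by blast
      have "reaches (at_label (Down3 s) (goal s) {} 2)
          (config_at Deploy ds2 (walk (goal s) ds1) (new_pebbles Keep (goal s) {})
            (new_carried Keep 2))"
        using prog tour[of s] ds by (intro reach_prefix) auto
      then show ?thesis
        using visitsI ds(3) by blast
    next
      case False
      have "reaches (at_label (Down3 s) (goal s) {} 2) (at_label Deploy (- width, base) {} 2)"
        using prog tour[of s] by (intro reaches_block) (simp add: block_def)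
      also have "reaches (at_label Deploy (- width, base) {} 2) (loop 0)"
        using deploy unfolding loop_def by (intro reaches_block) (simp add: block_def)
      finally show ?thesis
        using visits_trans loops_cover False by blast
    qed
    then show ?thesis
      using goal visits_trans by blast
  qed
  then show ?thesis
    unfolding explores_def start_compile visits_def by blast
qed

end

text \<open>With the whole grid as the target, the property depends on the blocked ports alone and
  is preserved by quarter turns.\<close>

definition explorable :: "(node \<Rightarrow> port \<Rightarrow> bool) \<Rightarrow> bool" where
  "explorable blocked \<longleftrightarrow> (\<exists>A :: nat automaton. valid_automaton 2 A \<and> explores blocked UNIV 2 A)"

lemma (in wall) explorable: "explorable blocked"
proof -
  have "\<exists>tour. \<forall>s. tour s \<noteq> [] \<and> free_path blocked (goal s) (tour s) \<and>
      walk (goal s) (tour s) = (- width, base) \<and>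
      (\<forall>u\<in>core. \<exists>ds1 ds2. tour s = ds1 @ ds2 \<and> ds1 \<noteq> [] \<and> walk (goal s) ds1 = u)"
    by (intro choice allI tour_exists finite_core)
  then obtain tour where tour: "\<And>s. tour s \<noteq> [] \<and> free_path blocked (goal s) (tour s) \<and>
      walk (goal s) (tour s) = (- width, base) \<and>
      (\<forall>u\<in>core. \<exists>ds1 ds2. tour s = ds1 @ ds2 \<and> ds1 \<noteq> [] \<and> walk (goal s) ds1 = u)"
    by blast
  obtain deploy where deploy: "deploy \<noteq> []" "free_path blocked (- width, base) deploy"
      "walk (- width, base) deploy = (width, base)"
    using tour_exists[of "{}" "(- width, base)" "(width, base)"] by blast
  let ?N = "5 + 2 * Suc (nat (hi - lo)) + length (tour True) + length (tour False) + length deploy"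
  interpret wall_agent blocked w lo hi tour deploy ?N ..
  have "valid_automaton 2 (compile ?N prog Start)"
    by (intro valid_compile length_plan)
  then show ?thesis
    unfolding explorable_def using explores_all[OF tour deploy] by blast
qed

section \<open>From wedges to walls\<close>

fun turn :: "node \<Rightarrow> node" where
  "turn (x, y) = (- y, x)"

fun turn_port :: "port \<Rightarrow> port" where
  "turn_port North = West"
| "turn_port East = North"
| "turn_port South = East"
| "turn_port West = South"

lemma neighbour_turn: "neighbour (turn u) (turn_port d) = turn (neighbour u d)"
  by (cases u; cases d) auto

lemma bij_turn: "bij turn"
  by (rule bij_betw_byWitness[where f' = "\<lambda>(x, y). (y, - x)"]) auto

lemma bij_turn_port: "bij turn_port"
proof -
  have "inj turn_port"
  proof (rule injI)
    fix d e
    show "turn_port d = turn_port e \<Longrightarrow> d = e"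
      by (cases d; cases e) auto
  qed
  then show ?thesis
    by (simp add: bij_def finite_UNIV_inj_surj)
qed

lemma opposite_turn: "opposite (turn_port d) = turn_port (opposite d)"
  by (cases d) auto

text \<open>Renaming the ports of an automaton for the pulled back grid makes its runs correspond,
  step by step, to runs at the turned positions.\<close>

lemma explorable_turn:
  assumes "explorable (\<lambda>u d. blocked (turn u) (turn_port d))"
  shows "explorable blocked"
proof -
  let ?blocked = "\<lambda>u d. blocked (turn u) (turn_port d)"
  obtain A :: "nat automaton" where valid: "valid_automaton 2 A" and A: "explores ?blocked UNIV 2 A"
    using assms unfolding explorable_def by blast
  let ?tr = "\<lambda>q F b k. case trans A q (turn_port -` F) b k of (q', act, d) \<Rightarrow> (q', act, turn_port d)"
  let ?A = "A \<lparr>trans := ?tr\<rparr>"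
  let ?c = "\<lambda>c. c \<lparr>position := turn (position c), pebbles := turn ` pebbles c\<rparr>"
  have inj: "inj turn" and surj: "surj turn" and surjp: "surj turn_port"
    using bij_turn bij_turn_port by (auto simp: bij_def)
  have "valid_automaton 2 ?A"
    unfolding valid_automaton_def
  proof (intro conjI ballI allI impI)
    show "finite (states ?A)" "init ?A \<in> states ?A"
      using valid by (auto simp: valid_automaton_def)
    fix q and F :: "port set" and b k
    assume "q \<in> states ?A" "F \<noteq> {} \<and> k \<le> (2 :: nat)"
    moreover have "turn_port -` F \<noteq> {}"
      using calculation surjp by (metis surj_image_vimage_eq image_empty)
    ultimately have "q \<in> states A" "turn_port -` F \<noteq> {} \<and> k \<le> 2"
      by simp_all
    then have "case trans A q (turn_port -` F) b k of (q', act, d) \<Rightarrow>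
           q' \<in> states A \<and> d \<in> turn_port -` F \<and>
           (act = Drop \<longrightarrow> \<not> b \<and> 0 < k) \<and> (act = Pick \<longrightarrow> b)"
      by (rule conjunct2[OF conjunct2[OF valid[unfolded valid_automaton_def]], THEN bspec, THEN spec, THEN spec,
            THEN spec, THEN mp])
    then show "case trans ?A q F b k of (q', act, d) \<Rightarrow>
           q' \<in> states ?A \<and> d \<in> F \<and> (act = Drop \<longrightarrow> \<not> b \<and> 0 < k) \<and> (act = Pick \<longrightarrow> b)"
      by (auto split: prod.splits)
  qed
  moreover have "explores blocked UNIV 2 ?A"
  proof -
    have step: "step blocked ?A (?c c) = ?c (step ?blocked A c)" for c :: "nat config"
    proof -
      have "turn_port -` {d. \<not> blocked (turn u) d} = {d. \<not> blocked (turn u) (turn_port d)}" for u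
        by auto
      moreover have "turn u \<in> turn ` B \<longleftrightarrow> u \<in> B" for u B
        using inj by (rule inj_image_mem_iff)
      moreover have "turn ` B - {turn u} = turn ` (B - {u})" for u B
        using inj by (simp add: image_set_diff)
      ultimately show ?thesis
        by (cases c) (auto
          simp: step_def Let_def neighbour_turn split: prod.splits pebble_action.splits)
    qed
    have steps: "(step blocked ?A ^^ n) (?c c)
        = ?c ((step ?blocked A ^^ n) c)" for n and c :: "nat config"
      by (induction n) (simp_all add: step)
    show ?thesis
      unfolding explores_def
    proof (intro ballI)
      fix s' v'
      obtain s v where sv: "s' = turn s" "v' = turn v"
        using surj by (metis surjD)
      obtain n where "position ((step ?blocked A ^^ n) (start 2 A s)) = v"
        using A unfolding explores_def by blast
      moreover have "start 2 ?A (turn s) = ?c (start 2 A s)"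
        by (simp add: start_def)
      ultimately show "\<exists>n. position ((step blocked ?A ^^ n) (start 2 ?A s')) = v'"
        using steps[of n "start 2 A s"] sv by (intro exI[of _ n]) simp
    qed
  qed
  ultimately show ?thesis
    unfolding explorable_def by blast
qed

text \<open>In these coordinates, the half-line from \<open>z\<close> in the direction of the unit vector \<open>h\<close> is
  the nonnegative real axis.\<close>

definition rel :: "complex \<Rightarrow> complex \<Rightarrow> node \<Rightarrow> complex" where
  "rel z h u = (point u - z) * cnj h"

definition left_of :: "complex \<Rightarrow> complex \<Rightarrow> node \<Rightarrow> bool" where
  "left_of z h u \<longleftrightarrow> 0 < Im (rel z h u)"

text \<open>A change of \<open>left_of\<close> means crossing the full line through the ray. The two
  bounds \<open>R\<close> cut the wall down to the ray, except for a bounded stretch around the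
  origin where each crossing edge may be blocked or free; this leaves room for the holes.\<close>

definition ray_wall :: "complex \<Rightarrow> complex \<Rightarrow> (node \<Rightarrow> port \<Rightarrow> bool) \<Rightarrow> bool" where
  "ray_wall z h blocked \<longleftrightarrow>
    (\<forall>u d. blocked (neighbour u d) (opposite d) = blocked u d) \<and>
    (\<forall>u d. blocked u d \<longrightarrow> left_of z h u \<noteq> left_of z h (neighbour u d)) \<and>
    (\<exists>R. \<forall>u d. left_of z h u \<noteq> left_of z h (neighbour u d) \<and> R \<le> Re (rel z h u) \<longrightarrow> blocked u d) \<and>
    (\<exists>R. \<forall>u d. blocked u d \<longrightarrow> R \<le> Re (rel z h u))"

lemma rel_turn: "rel z h (turn u) = rel (- \<i> * z) (- \<i> * h) u"
  by (cases u) (simp add: rel_def point_def complex_eq_iff algebra_simps)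

lemma ray_wall_turn:
  assumes "ray_wall z h blocked"
  shows "ray_wall (- \<i> * z) (- \<i> * h) (\<lambda>u d. blocked (turn u) (turn_port d))"
proof -
  have rel: "rel (- \<i> * z) (- \<i> * h) u = rel z h (turn u)" "left_of (- \<i> * z) (- \<i> * h) u
      = left_of z h (turn u)" for u
    by (simp_all only: left_of_def rel_turn)
  have sym: "blocked (neighbour u d) (opposite d) = blocked u d" for u d
    using assms unfolding ray_wall_def by blast
  have "blocked (turn (neighbour u d)) (turn_port (opposite d))
      = blocked (turn u) (turn_port d)" for u d
    using sym[of "turn u" "turn_port d"] by (simp add: neighbour_turn opposite_turn)
  moreover have "\<forall>u d. blocked (turn u) (turn_port d) \<longrightarrow>
      left_of z h (turn u) \<noteq> left_of z h (turn (neighbour u d))"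
    using assms unfolding ray_wall_def neighbour_turn[symmetric] by blast
  moreover have "\<exists>R. \<forall>u d. left_of z h (turn u) \<noteq> left_of z h (turn (neighbour u d)) \<and>
      R \<le> Re (rel z h (turn u)) \<longrightarrow>
      blocked (turn u) (turn_port d)"
    using assms unfolding ray_wall_def neighbour_turn[symmetric] by blast
  moreover have "\<exists>R. \<forall>u d. blocked (turn u) (turn_port d) \<longrightarrow> R \<le> Re (rel z h (turn u))"
    using assms unfolding ray_wall_def by blast
  ultimately show ?thesis
    unfolding ray_wall_def rel by blast
qed

section \<open>Rays as walls\<close>

lemma rel_neighbour:
  assumes "norm h = 1"
  shows "\<bar>Re (rel z h (neighbour u d)) - Re (rel z h u)\<bar> \<le> 1"
    "\<bar>Im (rel z h (neighbour u d)) - Im (rel z h u)\<bar> \<le> 1"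
proof -
  have "norm (point (neighbour u d) - point u) = 1"
    by (cases u; cases d) (auto simp: point_def cmod_def)
  then have "norm (rel z h (neighbour u d) - rel z h u) = 1"
    using assms by (simp add: rel_def norm_mult left_diff_distrib[symmetric])
  then show "\<bar>Re (rel z h (neighbour u d)) - Re (rel z h u)\<bar> \<le> 1"
    "\<bar>Im (rel z h (neighbour u d)) - Im (rel z h u)\<bar> \<le> 1"
    using abs_Re_le_cmod[of "rel z h (neighbour u d) - rel z h u"]
      abs_Im_le_cmod[of "rel z h (neighbour u d) - rel z h u"] by simp_all
qed

text \<open>Within 45 degrees of north, the line gives the column as an affine function of the row
  with slope \<open>c\<close> of absolute value at most 1. Rounding it up yields a \<open>w\<close>
  that changes by at most one per row.\<close>

lemma explorable_north:
  assumes "ray_wall z h blocked" "norm h = 1" "\<bar>Re h\<bar> \<le> Im h"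
  shows "explorable blocked"
proof -
  have hy: "0 < Im h"
    using assms(2,3) by (smt (verit) cmod_eq_Im norm_zero)
  define c where "c = Re h / Im h"
  have c: "\<bar>c\<bar> \<le> 1"
    using assms(3) hy by (simp add: c_def abs_divide)
  define w where "w y = \<lceil>Re z + c * (real_of_int y - Im z)\<rceil>" for y
  have left: "left_of z h (x, y) \<longleftrightarrow> x < w y" for x y
  proof -
    have "Im (rel z h (x, y)) = Im h * (Re z + c * (real_of_int y - Im z) - real_of_int x)"
      using hy by (simp add: rel_def point_def c_def field_simps)
    then show ?thesis
      using hy by (simp add: left_of_def w_def less_ceiling_iff zero_less_mult_iff)
  qed
  \<comment> \<open>The height above \<open>z\<close> is the imaginary part of
    \<open>rel z h (x, y) * h\<close>. This identity translates bounds along the ray into bounds on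
    rows, and conversely.\<close>
  have re: "Im h * Re (rel z h (x, y)) = real_of_int y - Im z - Re h * Im (rel z h (x, y))" for x y
  proof -
    have "Re h * Re h + Im h * Im h = 1"
      using assms(2) by (metis cmod_power2 one_power2 power2_eq_square)
    then have "(Re h * Re h + Im h * Im h) * (real_of_int y - Im z) = real_of_int y - Im z"
      by simp
    then show ?thesis
      by (simp add: rel_def point_def algebra_simps)
  qed
  obtain R1 where R1: "\<And>u d. left_of z h u \<noteq> left_of z h (neighbour u d) \<Longrightarrow> R1 \<le> Re (rel z h u) \<Longrightarrow>
      blocked u d"
    using assms(1) unfolding ray_wall_def by blast
  obtain R2 where R2: "\<And>u d. blocked u d \<Longrightarrow> R2 \<le> Re (rel z h u)"
    using assms(1) unfolding ray_wall_def by blast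
  have sym: "blocked (neighbour u d) (opposite d) = blocked u d"
    and sides: "blocked u d \<Longrightarrow> left_of z h u \<noteq> left_of z h (neighbour u d)" for u d
    using assms(1) unfolding ray_wall_def by blast+
  \<comment> \<open>The margin 1 absorbs the term \<open>Re h * Im (rel z h u)\<close>, which
    \<open>near\<close> bounds at crossing edges.\<close>
  define lo hi where "lo = \<lfloor>Im z - 1 - \<bar>R2\<bar>\<rfloor>" and "hi = \<lceil>Im z + 1 + \<bar>R1\<bar>\<rceil>"
  have h1: "\<bar>Re h\<bar> \<le> 1" "Im h \<le> 1"
    using abs_Re_le_cmod[of h] abs_Im_le_cmod[of h] assms(2) by auto
  have near: "\<bar>Re h * Im (rel z h u)\<bar> \<le> 1" if "left_of z h u \<noteq> left_of z h (neighbour u d)" for u d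
  proof -
    have "\<bar>Im (rel z h u)\<bar> \<le> 1"
      using that rel_neighbour(2)[OF assms(2), of z u d] by (auto simp: left_of_def)
    then show ?thesis
      using h1(1) by (metis abs_ge_zero abs_mult mult_le_one)
  qed
  have low: "lo \<le> y" if bl: "blocked (x, y) d" for x y d
  proof -
    have "- \<bar>R2\<bar> \<le> Im h * Re (rel z h (x, y))"
    proof (cases "0 \<le> Re (rel z h (x, y))")
      case True
      then have "0 \<le> Im h * Re (rel z h (x, y))"
        using hy by simp
      then show ?thesis
        by linarith
    next
      case False
      then have "1 * Re (rel z h (x, y)) \<le> Im h * Re (rel z h (x, y))"
        using h1(2) by (intro mult_right_mono_neg) auto
      then show ?thesis
        using R2[OF bl] by linarith
    qed
    then show ?thesis
      using re[of x y] near[OF sides[OF bl]] unfolding lo_def by linarith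
  qed
  have high: "blocked (x, y) d"
    if y: "hi \<le> y" and differ: "left_of z h (x, y) \<noteq> left_of z h (neighbour (x, y) d)" for x y d
  proof (rule R1[OF differ])
    have R: "\<bar>R1\<bar> \<le> Im h * Re (rel z h (x, y))"
      using re[of x y] near[OF differ] y unfolding hi_def by linarith
    then have "0 \<le> Re (rel z h (x, y))"
      using hy by (smt (verit) mult_pos_neg)
    then have "Im h * Re (rel z h (x, y)) \<le> 1 * Re (rel z h (x, y))"
      using h1(2) by (intro mult_right_mono) auto
    then show "R1 \<le> Re (rel z h (x, y))"
      using R by linarith
  qed
  have "wall blocked w lo hi"
  proof
    fix x y
    show "blocked (x, y) West \<longleftrightarrow> blocked (x - 1, y) East" "blocked (x, y) South \<longleftrightarrow>
        blocked (x, y - 1) North"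
      using sym[of "(x, y)" West] sym[of "(x, y)" South] by auto
    show "x + 1 = w y \<and> lo \<le> y" if "blocked (x, y) East"
      using sides[OF that] low[OF that] by (auto simp: left)
    show "(w y \<le> x) \<noteq> (w (y + 1) \<le> x) \<and> lo \<le> y" if "blocked (x, y) North"
      using sides[OF that] low[OF that] by (auto simp: left)
    show "blocked (w y - 1, y) East" if "hi \<le> y"
      using that by (intro high) (auto simp: left)
    show "blocked (x, y) North" if "hi \<le> y" "(w y \<le> x) \<noteq> (w (y + 1) \<le> x)"
      using that by (intro high) (auto simp: left)
    have "Re z + c * (real_of_int (y + 1) - Im z) = Re z + c * (real_of_int y - Im z) + c"
      by (simp add: algebra_simps)
    then show "\<bar>w (y + 1) - w y\<bar> \<le> 1"
      using c unfolding w_def by linarith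
    show "lo \<le> hi"
      unfolding lo_def hi_def by linarith
  qed
  then show ?thesis
    by (rule wall.explorable)
qed

lemma explorable_ray_wall:
  assumes "ray_wall z h blocked" "norm h = 1"
  shows "explorable blocked"
proof -
  have turn: "\<exists>z blocked'. ray_wall z (- \<i> * h) blocked' \<and> (explorable blocked' \<longrightarrow>
      explorable blocked)"
    if "ray_wall z h blocked" for z h blocked
    using ray_wall_turn[OF that] explorable_turn by blast
  obtain z1 b1 where 1: "ray_wall z1 (- \<i> * h) b1" "explorable b1 \<longrightarrow> explorable blocked"
    using turn[OF assms(1)] by blast
  obtain z2 b2 where 2: "ray_wall z2 (- \<i> * (- \<i> * h)) b2" "explorable b2 \<longrightarrow> explorable b1"
    using turn[OF 1(1)] by blast
  obtain z3 b3 where 3: "ray_wall z3 (- \<i> * (- \<i> * (- \<i> * h))) b3" "explorable b3 \<longrightarrow> explorable b2"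
    using turn[OF 2(1)] by blast
  \<comment> \<open>One of the four quarter turns of \<open>h\<close> lies within 45 degrees of
    north.\<close>
  have "\<bar>Re h\<bar> \<le> Im h \<or> \<bar>Im h\<bar> \<le> - Re h \<or> \<bar>Re h\<bar> \<le> - Im h \<or> \<bar>Im h\<bar> \<le> Re h"
    by linarith
  then show ?thesis
    using explorable_north[OF assms(1)] explorable_north[OF 1(1)] explorable_north[OF 2(1)]
      explorable_north[OF 3(1)]
      1(2) 2(2) 3(2) assms(2) by (auto simp: norm_mult)
qed

section \<open>Geometry of large wedges beside their first half-line\<close>

lemma not_in_wedge_imp_left:
  assumes "pi \<le> a1 - a2" and "u \<notin> wedge orig a1 a2"
  shows "left_of orig (cis a1) u"
proof (rule ccontr)
  let ?z = "rel orig (cis a1) u"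
  assume "\<not> ?thesis"
  then have "\<not> (0 < Arg ?z \<and> Arg ?z < pi)"
    by (simp add: left_of_def Arg_lt_pi)
  then have Arg: "Arg ?z \<le> 0 \<or> Arg ?z = pi"
    using Arg_le_pi[of ?z] by linarith
  \<comment> \<open>Turning clockwise from \<open>H1\<close> by at most \<open>pi\<close> stays
    within the wedge. On the negative axis \<open>Arg\<close> yields \<open>pi\<close>, while the
    clockwise turn is described by \<open>- pi\<close>.\<close>
  obtain t where t: "?z = of_real (norm ?z) * cis t" "- pi \<le> t" "t \<le> 0"
  proof (cases "Arg ?z = pi")
    case True
    have "cis (Arg ?z) = cis (- pi)"
      by (simp add: True complex_eq_iff)
    then show ?thesis
      using that[of "- pi"] rcis_cmod_Arg[of ?z] by (simp add: rcis_def)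
  next
    case False
    then show ?thesis
      using that[of "Arg ?z"] Arg mpi_less_Arg[of ?z] rcis_cmod_Arg[of ?z] by (simp add: rcis_def)
  qed
  have "point u = orig + ?z * cis a1"
    by (simp add: rel_def cis_cnj cis_mult mult.assoc)
  also have "\<dots> = orig + of_real (norm ?z) * cis (a1 + t)"
    by (subst t(1)) (simp add: cis_mult mult.assoc add.commute)
  finally have "point u \<in> half_line orig (a1 + t)"
    unfolding half_line_def by (auto intro!: exI[of _ "norm ?z"])
  moreover have "a1 + t \<in> {a2..a1}"
    using t assms(1) by auto
  ultimately show False
    using assms(2) unfolding wedge_def wedge_region_def by blast
qed

text \<open>In the quadrant ahead of the origin and to the left of \<open>H1\<close>, nodes of the
  wedge appear at an angle of at least \<open>b\<close>, the opening of the complement. If such a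
  node has height at most 1 over \<open>H1\<close>, its distance from the origin is at most
  \<open>1 / sin b\<close>.\<close>

lemma far_left_imp_not_in_wedge:
  assumes "a1 - a2 < 2 * pi"
  obtains R where "\<And>u. 0 < Im (rel orig (cis a1) u) \<Longrightarrow> Im (rel orig (cis a1) u) \<le> 1 \<Longrightarrow>
    R \<le> Re (rel orig (cis a1) u) \<Longrightarrow> u \<notin> wedge orig a1 a2"
proof -
  define b where "b = 2 * pi - (a1 - a2)"
  \<comment> \<open>The absolute value and the summand 1 make the real part positive whatever
    \<open>b\<close> is, which forces \<open>t\<close> into the first quadrant.\<close>
  let ?R = "\<bar>1 / sin b\<bar> + 1"
  have "u \<notin> wedge orig a1 a2"
    if z: "0 < Im (rel orig (cis a1) u)" "Im (rel orig (cis a1) u) \<le> 1" "?R \<le>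
        Re (rel orig (cis a1) u)" for u
  proof
    let ?z = "rel orig (cis a1) u"
    assume "u \<in> wedge orig a1 a2"
    then obtain a r where a: "a2 \<le> a" "a \<le> a1" and r: "0 \<le> r" "point u = orig + of_real r * cis a"
      unfolding wedge_def wedge_region_def half_line_def by auto
    define t where "t = 2 * pi - (a1 - a)"
    have "?z = of_real r * cis (a - a1)"
      by (simp add: rel_def r cis_cnj cis_mult mult.assoc)
    also have "cis (a - a1) = cis t"
      by (simp add: t_def complex_eq_iff cos_diff sin_diff)
    finally have rt: "Re ?z = r * cos t" "Im ?z = r * sin t"
      by simp_all
    have t: "b \<le> t" "t \<le> 2 * pi" "0 < b"
      using a assms by (auto simp: t_def b_def)
    have "0 < Re ?z"
      using z(3) by linarith
    then have pos: "0 < r" "0 < sin t" "0 < cos t"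
      using z(1) rt r(1) by (auto simp: zero_less_mult_iff)
    have "t < pi"
      using pos(2) t sin_le_zero[of t] by (cases "t = 2 * pi") (auto simp: not_le[symmetric])
    then have "t < pi / 2"
      using pos(3) t cos_monotone_0_pi_le[of "pi / 2" t] pi_gt_zero
      by (auto simp: not_le[symmetric])
    then have "sin b \<le> sin t" "0 < sin b"
      using t by (auto intro!: sin_monotone_2pi_le sin_gt_zero)
    then have "r * sin b \<le> r * sin t"
      using r(1) by (intro mult_left_mono) auto
    then have "r \<le> 1 / sin b"
      using z(2) rt(2) \<open>0 < sin b\<close> by (simp add: field_simps)
    moreover have "r * cos t \<le> r"
      using r(1) by (simp add: mult_left_le)
    ultimately show False
      using z(3) rt(1) by linarith
  qed
  then show thesis
    by (rule that)
qed

text \<open>Since all other ports are free, the blocked edges are exactly those of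
  \<open>?F1\<close>, read from either end. They are compared with the edges crossing the line
  through \<open>H1\<close>.\<close>

lemma semi_walled_imp_ray_wall:
  assumes large: "large a1 a2" and semi: "semi_walled orig a1 a2 blocked"
  shows "ray_wall orig (cis a1) blocked"
proof -
  let ?W = "wedge orig a1 a2" and ?H = "half_line orig a1"
  let ?F1 = "crossing_edges ?W ?H" and ?F2 = "crossing_edges ?W (half_line orig a2)"
  let ?r = "rel orig (cis a1)" and ?left = "left_of orig (cis a1)"
  have F1: "blocked u d \<and> blocked (neighbour u d) (opposite d)" if "(u, d) \<in> ?F1" for u d
    using semi that by (auto simp: semi_walled_def Let_def edges_blocked_def)
  have F2: "\<not> blocked u d \<and> \<not> blocked (neighbour u d) (opposite d)"
      if "(u, d) \<in> ?F2" "(u, d) \<notin> ?F1" for u d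
    using semi that by (auto simp: semi_walled_def Let_def edges_free_def)
  have free: "(u, d) \<notin> ?F1 \<union> ?F2 \<and> (neighbour u d, opposite d) \<notin> ?F1 \<union> ?F2 \<longrightarrow> \<not> blocked u d" for u d
    using semi unfolding semi_walled_def Let_def by blast
  have blocked_iff: "blocked u d \<longleftrightarrow> (u, d) \<in> ?F1 \<or> (neighbour u d, opposite d) \<in> ?F1" for u d
    using F1[of u d] F1[of "neighbour u d" "opposite d"] F2[of u d] F2[of "neighbour u d"
      "opposite d"] free[of u d]
    unfolding neighbour_opposite opposite_opposite by blast
  have "a1 - a2 \<noteq> 2 * pi"
  proof
    assume "a1 - a2 = 2 * pi"
    then have "cis a1 = cis (a2 + 2 * pi)"
      by (simp add: algebra_simps)
    then have "half_line orig a1 = half_line orig a2"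
      by (simp add: half_line_def cis_mult[symmetric])
    then show False
      using semi by (simp add: semi_walled_def)
  qed
  then have "pi \<le> a1 - a2" "a1 - a2 < 2 * pi"
    using large by (auto simp: large_def)
  note outside = not_in_wedge_imp_left[OF this(1)]
  obtain R where R: "\<And>u. 0 < Im (?r u) \<Longrightarrow> Im (?r u) \<le> 1 \<Longrightarrow> R \<le> Re (?r u) \<Longrightarrow> u \<notin> ?W"
    using far_left_imp_not_in_wedge[OF \<open>a1 - a2 < 2 * pi\<close>] by metis
  have segment: "(p - orig) * cnj (cis a1) = (1 - t) * ?r u + t * ?r v"
    if "p = (1 - t) * point u + t * point v" for p t u v
    unfolding that rel_def by (simp add: algebra_simps)
  have on_ray: "p \<in> ?H \<longleftrightarrow>
      Im ((p - orig) * cnj (cis a1)) = 0 \<and> 0 \<le> Re ((p - orig) * cnj (cis a1))" for p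
  proof
    assume "p \<in> ?H"
    then obtain \<rho> where "0 \<le> \<rho>" "p = orig + of_real \<rho> * cis a1"
      unfolding half_line_def by blast
    then have "(p - orig) * cnj (cis a1) = of_real \<rho>"
      by (simp add: cis_cnj cis_mult mult.assoc)
    then show "Im ((p - orig) * cnj (cis a1)) = 0 \<and> 0 \<le> Re ((p - orig) * cnj (cis a1))"
      using \<open>0 \<le> \<rho>\<close> by simp
  next
    let ?q = "(p - orig) * cnj (cis a1)"
    assume q: "Im ?q = 0 \<and> 0 \<le> Re ?q"
    then have "?q = of_real (Re ?q)"
      by (simp add: complex_eq_iff)
    moreover have "p = orig + ?q * cis a1"
      by (simp add: cis_cnj cis_mult mult.assoc)
    ultimately show "p \<in> ?H"
      using q unfolding half_line_def by (metis (mono_tags, lifting) mem_Collect_eq)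
  qed
  have step: "\<bar>Re (?r (neighbour u d)) - Re (?r u)\<bar> \<le> 1" "\<bar>Im (?r (neighbour u d)) - Im (?r u)\<bar> \<le>
      1" for u d
    by (rule rel_neighbour; simp)+
  \<comment> \<open>The outer end is on the left and the edge meets the line, so the inner end
    cannot be on the left as well. The meeting point has nonnegative real part and is at most one
    unit away, whence \<open>- 1\<close>.\<close>
  have crossing: "\<not> ?left u \<and> ?left (neighbour u d) \<and> - 1 \<le> Re (?r u)" if F: "(u, d) \<in> ?F1" for u d
  proof -
    let ?v = "neighbour u d"
    have v: "?left ?v"
      using F outside by (auto simp: crossing_edges_def)
    obtain p where p: "p \<in> ?H" "p \<in> closed_segment (point u) (point ?v)"
      using F by (auto simp: crossing_edges_def)
    then obtain t where t: "0 \<le> t" "t \<le> 1" "p = (1 - of_real t) * point u + of_real t * point ?v"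
      by (auto simp: closed_segment_def scaleR_conv_of_real)
    have eq: "(p - orig) * cnj (cis a1) = (1 - of_real t) * ?r u + of_real t * ?r ?v"
      using segment t(3) by simp
    have Im: "(1 - t) * Im (?r u) + t * Im (?r ?v)
        = 0" and Re: "0 \<le> (1 - t) * Re (?r u) + t * Re (?r ?v)"
      using p(1) unfolding on_ray eq by simp_all
    have "\<not> 0 < Im (?r u)"
    proof
      assume "0 < Im (?r u)"
      then have "0 < (1 - t) * Im (?r u) + t * Im (?r ?v)"
        using v t(1,2) unfolding left_of_def
        by (cases "t = 0") (auto intro: add_nonneg_pos)
      then show False
        using Im by simp
    qed
    moreover have "t * (Re (?r ?v) - Re (?r u)) \<le> t * 1"
      using t(1) step(1)[of u d] by (intro mult_left_mono) auto
    then have "- 1 \<le> Re (?r u)"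
      using Re t(2) by (simp add: algebra_simps)
    ultimately show ?thesis
      using v by (simp add: left_of_def)
  qed
  \<comment> \<open>The margin 1 keeps the outer end beyond \<open>R\<close> and the meeting point
    on the ray itself.\<close>
  have meets: "(u, d) \<in> ?F1"
      if "\<not> ?left u" "?left (neighbour u d)" "max R 0 + 1 \<le> Re (?r u)" for u d
  proof -
    let ?v = "neighbour u d"
    have Im: "Im (?r u) \<le> 0" "0 < Im (?r ?v)"
      using that by (auto simp: left_of_def)
    \<comment> \<open>The parameter at which the imaginary part, affine along the edge,
      vanishes.\<close>
    define t where "t = - Im (?r u) / (Im (?r ?v) - Im (?r u))"
    have t: "0 \<le> t" "t \<le> 1"
      using Im by (auto simp: t_def divide_simps)
    define p where "p = (1 - of_real t) * point u + of_real t * point ?v"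
    have eq: "(p - orig) * cnj (cis a1) = (1 - of_real t) * ?r u + of_real t * ?r ?v"
      using segment p_def by simp
    have "t * (Im (?r ?v) - Im (?r u)) = - Im (?r u)"
      using Im by (simp add: t_def)
    then have "Im ((p - orig) * cnj (cis a1)) = 0"
      unfolding eq by (simp add: algebra_simps)
    moreover have "t * (Re (?r u) - Re (?r ?v)) \<le> t * 1"
      using t(1) step(1)[of u d] by (intro mult_left_mono) auto
    then have "0 \<le> Re ((p - orig) * cnj (cis a1))"
      using that(3) t(2) unfolding eq by (simp add: algebra_simps)
    ultimately have "p \<in> ?H"
      unfolding on_ray by simp
    moreover have "p \<in> closed_segment (point u) (point ?v)"
      using t by (auto simp: closed_segment_def scaleR_conv_of_real p_def)
    moreover have "?v \<notin> ?W"
      using Im that(3) step[of u d] by (intro R) auto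
    moreover have "u \<in> ?W"
      using outside that(1) by blast
    ultimately show ?thesis
      by (auto simp: crossing_edges_def)
  qed
  show ?thesis
    unfolding ray_wall_def
  proof (intro conjI allI impI)
    fix u d
    show "blocked (neighbour u d) (opposite d) = blocked u d"
      unfolding blocked_iff neighbour_opposite opposite_opposite by blast
    show "?left u \<noteq> ?left (neighbour u d)" if "blocked u d"
      using that crossing[of u d] crossing[of "neighbour u d" "opposite d"]
      unfolding blocked_iff neighbour_opposite by blast
  next
    show "\<exists>R. \<forall>u d. ?left u \<noteq> ?left (neighbour u d) \<and> R \<le> Re (?r u) \<longrightarrow> blocked u d"
    proof (intro exI allI impI)
      fix u d
      \<comment> \<open>The margin is 2 instead of 1, as the edge may have to be read from its other
        end; the bound \<open>- 2\<close> below has the same origin.\<close>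
      assume "?left u \<noteq> ?left (neighbour u d) \<and> max R 0 + 2 \<le> Re (?r u)"
      then show "blocked u d"
        using meets[of u d] meets[of "neighbour u d" "opposite d"] step(1)[of u d]
        unfolding blocked_iff neighbour_opposite by (smt (verit))
    qed
    show "\<exists>R. \<forall>u d. blocked u d \<longrightarrow> R \<le> Re (?r u)"
    proof (intro exI allI impI)
      fix u d
      assume "blocked u d"
      then show "- 2 \<le> Re (?r u)"
        using crossing[of u d] crossing[of "neighbour u d" "opposite d"] step(1)[of u d]
        unfolding blocked_iff by (smt (verit))
    qed
  qed
qed

theorem theorem8:
  fixes orig :: complex and a1 a2 :: real and blocked :: "node \<Rightarrow> port \<Rightarrow> bool"
  assumes "large a1 a2"
    and "semi_walled orig a1 a2 blocked"
  shows "\<exists>A :: nat automaton. valid_automaton 2 A \<and> explores blocked (wedge orig a1 a2) 2 A"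
proof -
  obtain A :: "nat automaton" where "valid_automaton 2 A" "explores blocked UNIV 2 A"
    using explorable_ray_wall[OF
      semi_walled_imp_ray_wall[OF assms]] unfolding explorable_def by auto
  then show ?thesis
    unfolding explores_def by blast
qed

end
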